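(* Let $T\subset\mathbb{R}^3$ be the regular tetrahedron of edge length one, let $U$ be uniformly distributed on $S^2$, and put $B_T=b_T(U)$. Let $$\tau_0=\frac{1}{2\sqrt2},\quad \tau_1=\frac1{\sqrt6},\quad \tau_2=\frac{\sqrt3}{4},\quad \tau_3=\frac12,$$ and, for $\tau_0\le t\le\tau_1$, $$\eta(t)=\arcsin\left(\frac{\sqrt2\,t}{\sqrt{1-4t^2}}\right),\qquad \delta(t)=\arccos\left(\frac{\sqrt2\,t}{\sqrt{3-16t^2}}\right).$$ Then $B_T$ is absolutely continuous with support $[\tau_0,\tau_3]$, and a density representative is $$f_{B_T}(t)=\begin{cases}0,& t<\tau_0,\\ \dfrac{24}{\pi}\left(\eta(t)-\dfrac{\pi}{4}\right)+\dfrac{48}{\pi\sqrt3}\left(\dfrac{\pi}{3}-\delta(t)\right),& \tau_0\le t<\tau_1,\\ 6+\dfrac{16}{\sqrt3},& \tau_1\le t<\tau_2,\\ 6,& \tau_2\le t<\tau_3,\\ 0,& t\ge\tau_3.\end{cases}$$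
   Context: For a convex body $K\subset\mathbb{R}^3$ and $u\in S^2$, the brightness $b_K(u)$ is the area (two-dimensional volume) of the orthogonal projection of $K$ onto $u^{\perp}$. Concretely one may take $T=\operatorname{conv}\{v_1,v_2,v_3,v_4\}$ with $v_1=\frac{(1,1,1)}{\sqrt8}$, $v_2=\frac{(1,-1,-1)}{\sqrt8}$, $v_3=\frac{(-1,1,-1)}{\sqrt8}$, $v_4=\frac{(-1,-1,1)}{\sqrt8}$. "Uniformly distributed on $S^2$" refers to the rotation-invariant probability measure. *)

theory Defs
  imports "HOL-Probability.Probability"
begin

definition plane_isometry :: "(real^3) set \<Rightarrow> (real^2 \<Rightarrow> real^3) \<Rightarrow> bool" where
  "plane_isometry P L \<longleftrightarrow> linear L \<and> (\<forall>x. norm (L x) = norm x) \<and> range L = P"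

text \<open>The area of \<open>S\<close> inside a two-dimensional subspace \<open>P\<close> is the Lebesgue measure of \<open>S\<close> in
  orthonormal coordinates on \<open>P\<close>.  Such coordinates exist and, for compact \<open>S\<close>, the value does not
  depend on their choice: see \<open>plane_isometry_exists\<close> and \<open>plane_area_eq\<close> below.\<close>

definition plane_area :: "(real^3) set \<Rightarrow> (real^3) set \<Rightarrow> real" where
  "plane_area P S = measure lebesgue ((SOME L. plane_isometry P L) -` S)"

definition brightness :: "(real^3) set \<Rightarrow> real^3 \<Rightarrow> real" where
  "brightness K u = plane_area ({u}\<^sup>\<bottom>) ((\<lambda>x. x - (x \<bullet> u) *\<^sub>R u) ` K)"
  \<comment> \<open>the map is the orthogonal projection onto \<open>{u}\<^sup>\<bottom>\<close> because \<open>u\<close> is a unit vector\<close>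

lemma plane_isometry_exists:
  assumes "subspace P" "dim P = 2"
  shows "\<exists>L. plane_isometry P L"
proof -
  have "dim (UNIV :: (real^2) set) = dim P" using assms by simp
  from isometries_subspaces[OF subspace_UNIV assms(1) this]
  show ?thesis unfolding plane_isometry_def by (metis UNIV_I)
qed

lemma plane_isometry_inj:
  assumes "plane_isometry P L"
  shows "inj L"
proof -
  have "linear L" "\<And>x. L x = 0 \<Longrightarrow> x = 0"
    using assms unfolding plane_isometry_def by (auto, metis norm_eq_zero)
  then show ?thesis by (simp add: linear_injective_0)
qed

lemma plane_area_eq:
  assumes L: "plane_isometry P L" and S: "compact S"
  shows "plane_area P S = measure lebesgue (L -` S)"
proof -
  define L' where "L' = (SOME L. plane_isometry P L)"
  have L': "plane_isometry P L'"
    unfolding L'_def using L by (rule someI[where P = "plane_isometry P"])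
  have inj: "inj L" "inj L'" using L L' plane_isometry_inj by auto
  have lin: "linear L" "linear L'" and nrm: "\<And>x. norm (L x) = norm x" "\<And>x. norm (L' x) = norm x"
    and ran: "range L = P" "range L' = P"
    using L L' by (auto simp: plane_isometry_def)
  define Q where "Q = (\<lambda>x. inv L (L' x))"
  have LQ: "L (Q x) = L' x" for x
    unfolding Q_def using ran by (metis f_inv_into_f rangeI)
  have "linear Q"
  proof (rule linearI)
    fix x y :: "real^2" and r :: real
    show "Q (x + y) = Q x + Q y"
      by (rule injD[OF inj(1)]) (simp add: LQ linear_add[OF lin(1)] linear_add[OF lin(2)])
    show "Q (r *\<^sub>R x) = r *\<^sub>R Q x"
      by (rule injD[OF inj(1)]) (simp add: LQ linear_scale[OF lin(1)] linear_scale[OF lin(2)])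
  qed
  moreover have "norm (Q x) = norm x" for x
    by (metis LQ nrm)
  ultimately have Q: "orthogonal_transformation Q"
    by (simp add: orthogonal_transformation)
  then have "surj Q" by (rule orthogonal_transformation_surj)
  have img: "L -` S = Q ` (L' -` S)"
  proof
    show "L -` S \<subseteq> Q ` (L' -` S)"
    proof
      fix y assume "y \<in> L -` S"
      moreover obtain x where "y = Q x" using \<open>surj Q\<close> by (metis surjD)
      ultimately show "y \<in> Q ` (L' -` S)" using LQ by auto
    qed
    show "Q ` (L' -` S) \<subseteq> L -` S" using LQ by auto
  qed
  have "closed (L' -` S)"
    by (rule closed_vimage)
      (use S lin in \<open>auto simp: compact_imp_closed linear_continuous_on linear_conv_bounded_linear\<close>)
  moreover obtain B where "\<And>y. y \<in> S \<Longrightarrow> norm y \<le> B"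
    using compact_imp_bounded[OF S] by (auto simp: bounded_iff)
  then have "bounded (L' -` S)"
    unfolding bounded_iff using nrm(2) by (metis vimageE)
  ultimately have "L' -` S \<in> lmeasurable"
    by (simp add: compact_eq_bounded_closed lmeasurable_compact)
  from measure_orthogonal_image[OF Q this]
  show ?thesis unfolding plane_area_def L'_def[symmetric] img by simp
qed

definition unit_regular_tetrahedron :: "(real^3) set \<Rightarrow> bool" where
  "unit_regular_tetrahedron T \<longleftrightarrow>
     (\<exists>V. card V = 4 \<and> (\<forall>x\<in>V. \<forall>y\<in>V. x \<noteq> y \<longrightarrow> dist x y = 1) \<and> T = convex hull V)"

lemma concrete_unit_regular_tetrahedron:
  "unit_regular_tetrahedron (convex hull
     {vector [1, 1, 1] /\<^sub>R sqrt 8, vector [1, -1, -1] /\<^sub>R sqrt 8,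
      vector [-1, 1, -1] /\<^sub>R sqrt 8, vector [-1, -1, 1] /\<^sub>R sqrt 8})"
  (is "unit_regular_tetrahedron (convex hull {?a, ?b, ?c, ?d})")
proof -
  have d: "dist (x /\<^sub>R sqrt 8) (y /\<^sub>R sqrt 8) = 1"
    if "(x$1 - y$1)^2 + (x$2 - y$2)^2 + (x$3 - y$3)^2 = 8" for x y :: "real^3"
  proof -
    have "x /\<^sub>R sqrt 8 - y /\<^sub>R sqrt 8 = (x - y) /\<^sub>R sqrt 8"
      by (simp add: scaleR_diff_right)
    moreover have "norm (x - y) = sqrt 8"
      using that by (simp add: norm_vec_def L2_set_def sum_3)
    ultimately show ?thesis by (simp add: dist_norm)
  qed
  have e: "dist ?a ?b = 1" "dist ?a ?c = 1" "dist ?a ?d = 1"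
    "dist ?b ?c = 1" "dist ?b ?d = 1" "dist ?c ?d = 1"
    by (rule d; simp add: vector_3)+
  then have "?a \<noteq> ?b" "?a \<noteq> ?c" "?a \<noteq> ?d" "?b \<noteq> ?c" "?b \<noteq> ?d" "?c \<noteq> ?d"
    by (metis dist_self zero_neq_one)+
  then have "card {?a, ?b, ?c, ?d} = 4" by simp
  moreover have "\<forall>x\<in>{?a, ?b, ?c, ?d}. \<forall>y\<in>{?a, ?b, ?c, ?d}. x \<noteq> y \<longrightarrow> dist x y = 1"
    using e by (simp add: dist_commute)
  ultimately show ?thesis unfolding unit_regular_tetrahedron_def by blast
qed

definition sphere_algebra :: "(real^3) measure" where
  "sphere_algebra = restrict_space borel (sphere 0 1)"

definition rotation_invariant_prob :: "(real^3) measure \<Rightarrow> bool" where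
  "rotation_invariant_prob \<mu> \<longleftrightarrow>
     prob_space \<mu> \<and> sets \<mu> = sets sphere_algebra \<and>
     (\<forall>Q. rotation_matrix Q \<longrightarrow> distr \<mu> sphere_algebra (\<lambda>x. Q *v x) = \<mu>)"

definition uniform_on_sphere :: "'a measure \<Rightarrow> ('a \<Rightarrow> real^3) \<Rightarrow> bool" where
  "uniform_on_sphere M U \<longleftrightarrow>
     U \<in> M \<rightarrow>\<^sub>M sphere_algebra \<and> rotation_invariant_prob (distr M sphere_algebra U)"

definition law_support :: "real measure \<Rightarrow> real set" where
  "law_support \<mu> = {x. \<forall>W. open W \<and> x \<in> W \<longrightarrow> emeasure \<mu> W > 0}"

definition \<tau>\<^sub>0 :: real where "\<tau>\<^sub>0 = 1 / (2 * sqrt 2)"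
definition \<tau>\<^sub>1 :: real where "\<tau>\<^sub>1 = 1 / sqrt 6"
definition \<tau>\<^sub>2 :: real where "\<tau>\<^sub>2 = sqrt 3 / 4"
definition \<tau>\<^sub>3 :: real where "\<tau>\<^sub>3 = 1 / 2"

definition \<eta> :: "real \<Rightarrow> real" where
  "\<eta> t = arcsin (sqrt 2 * t / sqrt (1 - 4 * t\<^sup>2))"

definition \<delta> :: "real \<Rightarrow> real" where
  "\<delta> t = arccos (sqrt 2 * t / sqrt (3 - 16 * t\<^sup>2))"

definition f_BT :: "real \<Rightarrow> real" where
  "f_BT t =
     (if t < \<tau>\<^sub>0 then 0
      else if t < \<tau>\<^sub>1 then 24 / pi * (\<eta> t - pi / 4) + 48 / (pi * sqrt 3) * (pi / 3 - \<delta> t)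
      else if t < \<tau>\<^sub>2 then 6 + 16 / sqrt 3
      else if t < \<tau>\<^sub>3 then 6
      else 0)"

end

theory Submission
  imports Defs
begin

text \<open>In the orthonormal frame of the bimedians of the tetrahedron, the brightness of \<open>T\<close> in direction
  \<open>u = (x, y, z)\<close> is the maximum of \<open>max \<bar>x\<bar> \<bar>y\<bar> \<bar>z\<bar> / 2\<close> and \<open>(\<bar>x\<bar> + \<bar>y\<bar> + \<bar>z\<bar>) / 4\<close>. The first
  term dominates on six congruent regions around the coordinate axes, the second on eight congruent
  regions around the space diagonals. Within each region the brightness is a multiple of the
  coordinate of \<open>u\<close> along the axis of the region. That coordinate is uniform on \<open>[-1, 1]\<close>, and the
  part of each circle of latitude that lies in the region is found by removing four, respectively
  three, congruent arcs, whose lengths give \<open>\<eta>\<close> and \<open>\<delta>\<close>.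

  For an arbitrary rotation-invariant law, uniformity of the coordinate follows from its moments:
  invariance gives a recursion for them. The arcs come in by averaging over the rotations about
  the axis, which avoids surface measure altogether.\<close>

text \<open>Four great circles, \<open>x = y + z\<close> and its images under sign changes, cut the
  sphere into the faces of a cuboctahedron projected from its centre: six squares and eight
  triangles. This explains the constants. The brightness is \<open>\<tau>\<^sub>0\<close> at the
  vertices, such as \<open>(1, 1, 0) / sqrt 2\<close>, \<open>\<tau>\<^sub>2\<close> at the centres
  of the triangles, \<open>\<tau>\<^sub>3\<close> at the centres of the squares, and
  \<open>\<tau>\<^sub>1\<close> at the edge midpoints, such as \<open>(2, 1, 1) / sqrt 6\<close>. A
  midpoint is the point of its edge nearest to the centres of both adjacent faces, so the arcs of
  both kinds vanish at the same level. The cap bounded at level \<open>\<tau>\<^sub>0\<close> passes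
  through all vertices of its face, so the parts outside the face are disjoint. A coordinate has
  density 1/2; the factors \<open>1 / 2\<close> on squares and \<open>sqrt 3 / 4\<close> on
  triangles turn this into 1 and \<open>2 / sqrt 3\<close>, hence the plateau
  \<open>6 + 16 / sqrt 3\<close>. The brightness formula rests on the faces of \<open>T\<close>:
  their projected areas add up to twice the brightness, and each is proportional to the height over
  the centroid, in direction \<open>u\<close>, of the opposite vertex.\<close>

unbundle cross3_syntax

subsection \<open>Moments of laws on $[-1, 1]$\<close>

text \<open>On \<open>[-1, 1]\<close> all absolute moments are at most 1, so the Taylor polynomials
  of the characteristic function converge to it with error at most
  \<open>2 * \<bar>t\<bar> ^ n / fact n\<close>. The moments therefore fix the characteristic
  function, and with it the law.\<close>

lemma bounded_moments_determine:
  assumes "real_distribution M1" "real_distribution M2"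
    and b: "AE x in M1. \<bar>x\<bar> \<le> 1" "AE x in M2. \<bar>x\<bar> \<le> 1"
    and eq: "\<And>k. (\<integral>x. x ^ k \<partial>M1) = (\<integral>x. x ^ k \<partial>M2)"
  shows "M1 = M2"
proof (rule Levy_uniqueness[OF assms(1,2)], rule ext)
  fix t :: real
  have *: "(\<lambda>n. \<Sum>k\<le>n. ((\<i> * t)^k / fact k) * (\<integral>x. x ^ k \<partial>M)) \<longlonglongrightarrow> char M t"
    if M: "real_distribution M" and b: "AE x in M. \<bar>x\<bar> \<le> 1" for M
  proof -
    interpret real_distribution M by fact
    have int: "integrable M (\<lambda>x. x ^ k)" for k
      by (rule integrable_const_bound[where B = 1]) (use b in \<open>auto simp: power_abs power_le_one\<close>)
    have "expectation (\<lambda>x. \<bar>x\<bar> ^ n) \<le> expectation (\<lambda>_. 1)" for n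
    proof (rule integral_mono_AE)
      show "integrable M (\<lambda>x. \<bar>x\<bar> ^ n)" using int[THEN integrable_abs] by (simp add: power_abs)
    qed (use b in \<open>auto simp: power_le_one\<close>)
    then have le: "expectation (\<lambda>x. \<bar>x\<bar> ^ n) \<le> 1" for n by (simp add: prob_space del: space_eq_univ)
    have lim: "(\<lambda>n. 2 * (\<bar>t\<bar> ^ n / fact n)) \<longlonglongrightarrow> 0"
      using tendsto_mult_right_zero[OF summable_LIMSEQ_zero[OF summable_exp[of "\<bar>t\<bar>"]], of 2]
      by (simp add: field_simps)
    have "cmod (char M t - (\<Sum>k \<le> n. ((\<i> * t)^k / fact k) * expectation (\<lambda>x. x^k)))
       \<le> 2 * (\<bar>t\<bar> ^ n / fact n)" for n
      using char_approx1[of n t, OF int] mult_left_mono[OF le, of "2 * \<bar>t\<bar> ^ n / fact n" n] by simp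
    then have "(\<lambda>n. char M t - (\<Sum>k \<le> n. ((\<i> * t)^k / fact k) * expectation (\<lambda>x. x^k))) \<longlonglongrightarrow> 0"
      by (intro Lim_null_comparison[OF _ lim]) auto
    from tendsto_diff[OF tendsto_const this, of "char M t"] show ?thesis by simp
  qed
  from *[OF assms(1) b(1)] *[OF assms(2) b(2)] show "char M1 t = char M2 t"
    unfolding eq by (rule LIMSEQ_unique)
qed

definition unif :: "real measure" where
  "unif = density lborel (\<lambda>x. ennreal (indicator {-1..1} x / 2))"

lemma integral_unif:
  fixes f :: "real \<Rightarrow> real"
  assumes [measurable]: "f \<in> borel_measurable borel"
  shows "(\<integral>x. f x \<partial>unif) = (LINT x:{-1..1}|lborel. f x) / 2"
  unfolding unif_def
  by (subst integral_real_density) (auto simp: set_lebesgue_integral_def)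

lemma uniform_moment:
  "(\<integral>x. x ^ k \<partial>unif) = (1 - (-1) ^ Suc k) / (2 * Suc k)"
proof -
  have "((\<lambda>x::real. x ^ k) has_integral (1 ^ Suc k / Suc k - (-1) ^ Suc k / Suc k)) {-1..1}"
    by (rule fundamental_theorem_of_calculus)
       (auto intro!: derivative_eq_intros simp flip: has_real_derivative_iff_has_vector_derivative
         simp del: power_Suc of_nat_Suc)
  moreover have "set_integrable lborel {-1..1::real} (\<lambda>x. x ^ k)"
    by (rule borel_integrable_atLeastAtMost') (auto intro!: continuous_intros)
  ultimately have "(LINT x:{-1..1::real}|lborel. x ^ k) = (1 - (-1) ^ Suc k) / Suc k"
    by (metis (no_types, lifting) set_borel_integral_eq_integral(2) integral_unique diff_divide_distrib power_one)
  then show ?thesis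
    by (simp only: integral_unif[OF borel_measurable_power[OF measurable_ident_sets[OF refl]]] divide_divide_eq_left mult.commute of_nat_mult of_nat_numeral)
qed

lemma real_distribution_unif: "real_distribution unif"
proof -
  have "emeasure unif UNIV = (\<integral>\<^sup>+ (x::real). ennreal (indicator {-1..1} x / 2) \<partial>lborel)"
    unfolding unif_def by (subst emeasure_density) simp_all
  also have "\<dots> = (\<integral>\<^sup>+ (x::real). ennreal (1/2) * indicator {-1..1} x \<partial>lborel)"
    by (rule nn_integral_cong) (simp split: split_indicator)
  also have "\<dots> = ennreal (1/2) * ennreal 2"
    by (subst nn_integral_cmult_indicator) auto
  also have "\<dots> = 1" by (subst ennreal_mult[symmetric]) auto
  finally have "emeasure unif (space unif) = 1" by (simp add: unif_def)
  then have "prob_space unif" by (rule prob_spaceI)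
  then show ?thesis
    by (simp add: real_distribution_def real_distribution_axioms_def unif_def)
qed

lemma AE_unif: "AE x in unif. \<bar>x\<bar> \<le> 1"
  unfolding unif_def by (subst AE_density) (auto simp: indicator_def)

subsection \<open>Coordinates of a rotation-invariant direction\<close>

text \<open>Only two vectors are recorded: \<open>n \<times> p\<close> completes them to a
  positively oriented frame, the kind that rotation matrices provide.\<close>

definition orthonormal :: "real^3 \<Rightarrow> real^3 \<Rightarrow> bool" where
  "orthonormal n p \<longleftrightarrow> norm n = 1 \<and> norm p = 1 \<and> n \<bullet> p = 0"

lemma inner_3: "(x::real^3) \<bullet> y = x$1 * y$1 + x$2 * y$2 + x$3 * y$3"
  by (simp add: inner_vec_def sum_3)

lemma frame_rotation:
  assumes "orthonormal n p"
  shows "rotation_matrix (vector [n, p, n \<times> p] :: real^3^3)"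
proof -
  let ?Q = "vector [n, p, n \<times> p] :: real^3^3"
  have np: "n \<bullet> n = 1" "p \<bullet> p = 1" "n \<bullet> p = 0" "p \<bullet> n = 0"
    using assms by (auto simp: orthonormal_def norm_eq_1 inner_commute)
  have c: "(n \<times> p) \<bullet> (n \<times> p) = 1"
    using norm_cross_dot[of n p] assms np by (simp add: orthonormal_def power2_norm_eq_inner)
  have rows: "row 1 ?Q = n" "row 2 ?Q = p" "row 3 ?Q = n \<times> p"
    by (simp_all add: row_def vec_eq_iff vector_3)
  have "orthogonal_matrix ?Q"
    unfolding orthogonal_matrix_orthonormal_rows forall_3
    using c np by (auto simp: rows orthogonal_def norm_eq_1 dot_cross_self inner_commute)
  moreover have "det ?Q = 1"
    unfolding dot_cross_det[symmetric] Lagrange by (simp add: np inner_diff_right)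
  ultimately show ?thesis by (simp add: rotation_matrix_def)
qed

lemma frame_parseval:
  assumes "orthonormal n p"
  shows "(n \<bullet> u)\<^sup>2 + (p \<bullet> u)\<^sup>2 + ((n \<times> p) \<bullet> u)\<^sup>2 = (norm u)\<^sup>2"
proof -
  let ?Q = "vector [n, p, n \<times> p] :: real^3^3"
  have "orthogonal_transformation ((*v) ?Q)"
    using frame_rotation[OF assms] by (simp add: rotation_matrix_def orthogonal_transformation_matrix)
  then have "norm (?Q *v u) = norm u" by (simp add: orthogonal_transformation)
  then have "(norm u)\<^sup>2 = (?Q *v u) \<bullet> (?Q *v u)" by (metis power2_norm_eq_inner)
  then show ?thesis
    by (simp add: inner_3 matrix_vector_mult_def sum_3 vector_3 power2_eq_square)
qed

lemma frame_expansion: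
  assumes np: "orthonormal n p"
  shows "u = (n \<bullet> u) *\<^sub>R n + (p \<bullet> u) *\<^sub>R p + ((n \<times> p) \<bullet> u) *\<^sub>R (n \<times> p)"
proof -
  have n1: "n \<bullet> n = 1" "p \<bullet> p = 1" "n \<bullet> p = 0" "p \<bullet> n = 0"
    using np by (auto simp: orthonormal_def norm_eq_1 inner_commute)
  have c: "(n \<times> p) \<bullet> (n \<times> p) = 1"
    using norm_cross_dot[of n p] np n1 by (simp add: orthonormal_def power2_norm_eq_inner)
  define d where "d = u - ((n \<bullet> u) *\<^sub>R n + (p \<bullet> u) *\<^sub>R p + ((n \<times> p) \<bullet> u) *\<^sub>R (n \<times> p))"
  have "n \<bullet> d = 0" "p \<bullet> d = 0" "(n \<times> p) \<bullet> d = 0"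
    by (simp_all add: d_def inner_diff_right inner_add_right n1 c dot_cross_self)
  then have "(norm d)\<^sup>2 = 0" using frame_parseval[OF np, of d] by simp
  then show ?thesis by (simp add: d_def)
qed

lemma frame_third:
  assumes np: "orthonormal n p" and r: "norm r = 1" "n \<bullet> r = 0" "p \<bullet> r = 0"
  shows "r = n \<times> p \<or> r = - (n \<times> p)"
proof -
  have "((n \<times> p) \<bullet> r)\<^sup>2 = 1" using frame_parseval[OF np, of r] r by simp
  then have "(n \<times> p) \<bullet> r = 1 \<or> (n \<times> p) \<bullet> r = -1" by (simp add: power2_eq_1_iff)
  then show ?thesis using frame_expansion[OF np, of r] r by auto
qed

lemma coeff_one_plus_square_power: "coeff ([:1, 0, 1:] ^ k) 2 = real k" "coeff ([:1, 0, 1::real:] ^ k) 0 = 1"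
  by (induction k) (auto simp: numeral_2_eq_2 coeff_pCons split: nat.splits)

text \<open>The law is placed on all of \<open>real^3\<close>, with unit norm almost everywhere, so
  that linear functionals are plain Borel functions; \<open>uniform_on_sphere_invariant\<close>
  supplies the passage from the sphere.\<close>

locale rotation_invariant = prob_space N for N :: "(real^3) measure" +
  assumes sets_N [measurable_cong, simp]: "sets N = sets borel"
    and norm_1: "AE u in N. norm u = 1"
    and rot: "rotation_matrix Q \<Longrightarrow> distr N borel ((*v) Q) = N"
begin

text \<open>The matrix with rows \<open>n\<close>, \<open>p\<close>, \<open>n \<times> p\<close> is
  a rotation and carries these coordinates to the first two. Pairs rather than triples keep the
  statement free of orientation: an orthonormal pair always extends to a rotation.\<close>

lemma distr_joint:
  assumes "orthonormal n p"
  shows "distr N borel (\<lambda>u. (n \<bullet> u, p \<bullet> u)) = distr N borel (\<lambda>u. (u$1, u$2))"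
proof -
  let ?Q = "vector [n, p, n \<times> p] :: real^3^3"
  have *: "(\<lambda>u::real^3. (u$1, u$2)) \<in> borel_measurable borel" "(*v) ?Q \<in> borel_measurable borel"
    by (intro borel_measurable_continuous_onI continuous_intros linear_continuous_on
        matrix_vector_mul_bounded_linear)+
  have "distr N borel (\<lambda>u. (u$1, u$2)) = distr (distr N borel ((*v) ?Q)) borel (\<lambda>u. (u$1, u$2))"
    by (simp add: rot[OF frame_rotation[OF assms]])
  also have "\<dots> = distr N borel (\<lambda>u. (n \<bullet> u, p \<bullet> u))"
    using * by (subst distr_distr)
      (auto intro!: distr_cong simp: matrix_vector_mult_def inner_vec_def vector_3)
  finally show ?thesis by simp
qed

lemma measurable_coord [measurable]: "(\<lambda>u. u $ i) \<in> borel_measurable N"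
  by (subst measurable_cong_sets[OF sets_N refl])
    (intro borel_measurable_continuous_onI continuous_intros)

lemma measurable_inner [measurable]: "(\<lambda>u. n \<bullet> u) \<in> borel_measurable N"
  by (subst measurable_cong_sets[OF sets_N refl])
    (intro borel_measurable_continuous_onI continuous_intros)

lemma measurable_pair:
  "(\<lambda>u. (n \<bullet> u, p \<bullet> u)) \<in> N \<rightarrow>\<^sub>M borel" "(\<lambda>u. (u $ i, u $ j)) \<in> N \<rightarrow>\<^sub>M borel"
  by (intro borel_measurable_Pair measurable_inner measurable_coord)+

lemma integral_joint:
  assumes "orthonormal n p" and [measurable]: "f \<in> borel_measurable borel"
  shows "(\<integral>u. f (n \<bullet> u, p \<bullet> u) \<partial>N) = (\<integral>u. f (u$1, u$2) \<partial>N :: real)"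
proof -
  have "(\<integral>u. f (n \<bullet> u, p \<bullet> u) \<partial>N) = (\<integral>x. f x \<partial>distr N borel (\<lambda>u. (n \<bullet> u, p \<bullet> u)))"
    by (subst integral_distr) (simp_all add: measurable_pair)
  also have "\<dots> = (\<integral>u. f (u$1, u$2) \<partial>N)"
    unfolding distr_joint[OF assms(1)]
    by (subst integral_distr) (simp_all add: measurable_pair)
  finally show ?thesis .
qed

lemma exists_orthonormal: "norm n = 1 \<Longrightarrow> \<exists>p. orthonormal n p"
proof -
  assume n: "norm n = 1"
  obtain x where x: "x \<noteq> 0" "orthogonal n x"
    using orthogonal_to_vector_exists[of n] by (auto)
  then have "orthonormal n (x /\<^sub>R norm x)"
    using n by (auto simp: orthonormal_def orthogonal_def)
  then show ?thesis ..
qed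

lemma integral_single:
  assumes "norm n = 1" and [measurable]: "f \<in> borel_measurable borel"
  shows "(\<integral>u. f (n \<bullet> u) \<partial>N) = (\<integral>u. f (u$1) \<partial>N :: real)"
proof -
  obtain p where "orthonormal n p" using exists_orthonormal[OF assms(1)] by blast
  then have "(\<integral>u. (\<lambda>(x, y). f x) (n \<bullet> u, p \<bullet> u) \<partial>N) = (\<integral>u. (\<lambda>(x, y). f x) (u$1, u$2) \<partial>N)"
    by (rule integral_joint) (simp flip: borel_prod)
  then show ?thesis by simp
qed

lemma AE_coord_le: "AE u in N. \<bar>u $ i\<bar> \<le> 1"
  using norm_1 by eventually_elim (metis component_le_norm_cart)

lemma integrable_monomial: "integrable N (\<lambda>u. (u $ i) ^ a * (u $ j) ^ b)"
proof (rule integrable_const_bound[where B = 1])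
  show "AE u in N. norm ((u $ i) ^ a * (u $ j) ^ b) \<le> 1"
    using AE_coord_le[of i] AE_coord_le[of j]
    by eventually_elim (auto simp: abs_mult power_abs intro!: mult_le_one power_le_one)
qed simp

text \<open>The law of \<open>u$1 + r * u$2\<close> is that of \<open>sqrt (1 + r\<^sup>2) * u$1\<close>; the identity compares the
  coefficients of \<open>r\<^sup>2\<close> in the even moments.\<close>

lemma moment_mixed:
  "(2 * k + 1) * (\<integral>u. (u$1) ^ (2 * k) * (u$2)\<^sup>2 \<partial>N) = (\<integral>u. (u$1) ^ (2 * k + 2) \<partial>N)"
proof -
  define m where "m = 2 * k + 2"
  define a where "a j = (\<integral>u. (u$1) ^ (m - j) * (u$2) ^ j \<partial>N)" for j
  define P where "P = (\<Sum>j\<le>m. monom (real (m choose j) * a j) j)"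
  have "poly P r = poly (smult (a 0) ([:1, 0, 1:] ^ (k + 1))) r" for r
  proof -
    define s where "s = sqrt (1 + r\<^sup>2)"
    have s: "s > 0" "s\<^sup>2 = 1 + r\<^sup>2" by (auto simp: s_def add_pos_nonneg)
    define n :: "real^3" where "n = vector [1 / s, r / s, 0]"
    have "n \<bullet> n = (1 + r\<^sup>2) / s\<^sup>2"
      by (simp add: n_def inner_3 vector_3 power2_eq_square add_divide_distrib)
    moreover have "s\<^sup>2 \<noteq> 0" using s(1) by simp
    ultimately have n: "norm n = 1" by (simp add: norm_eq_1 s(2))
    have nu: "u$1 + r * u$2 = s * (n \<bullet> u)" for u
      using s by (simp add: n_def inner_3 vector_3 field_simps)
    have "poly P r = (\<Sum>j\<le>m. (\<integral>u. real (m choose j) * ((u$1) ^ (m - j) * (u$2) ^ j) * r ^ j \<partial>N))"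
      by (simp add: P_def a_def poly_sum poly_monom)
    also have "\<dots> = (\<integral>u. (\<Sum>j\<le>m. real (m choose j) * ((u$1) ^ (m - j) * (u$2) ^ j) * r ^ j) \<partial>N)"
      by (subst Bochner_Integration.integral_sum) (auto intro!: integrable_monomial)
    also have "\<dots> = (\<integral>u. (u$1 + r * u$2) ^ m \<partial>N)"
      by (subst add.commute, subst binomial_ring) (simp add: power_mult_distrib mult_ac)
    also have "\<dots> = (\<integral>u. s ^ m * (n \<bullet> u) ^ m \<partial>N)"
      by (simp add: nu power_mult_distrib)
    also have "\<dots> = s ^ m * (\<integral>u. (u$1) ^ m \<partial>N)"
      using integral_single[OF n, of "\<lambda>x. x ^ m"] by simp
    also have "s ^ m = (1 + r\<^sup>2) ^ (k + 1)"
      unfolding s(2)[symmetric] m_def by (simp flip: power_mult power_add)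
    finally show ?thesis by (simp add: a_def poly_power power2_eq_square algebra_simps)
  qed
  then have "P = smult (a 0) ([:1, 0, 1:] ^ (k + 1))" by (intro poly_eq_poly_eq_iff[THEN iffD1] ext)
  then have "coeff P 2 = a 0 * real (k + 1)" by (simp only: coeff_smult coeff_one_plus_square_power)
  moreover have "2 \<le> m" by (simp add: m_def)
  then have "coeff P 2 = real (m choose 2) * a 2"
    by (simp add: P_def coeff_sum)
  moreover have "m choose 2 = (2 * ((k + 1) * (2 * k + 1))) div 2"
    unfolding choose_two m_def by (simp add: algebra_simps)
  then have "m choose 2 = (k + 1) * (2 * k + 1)" by simp
  ultimately have "real (k + 1) * (real (2 * k + 1) * a 2) = real (k + 1) * a 0"
    by (metis mult.assoc mult.commute of_nat_mult)
  then have "real (2 * k + 1) * a 2 = a 0"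
    by (subst (asm) mult_cancel_left) linarith
  then show ?thesis by (simp add: a_def m_def add.commute)
qed

text \<open>Inserting \<open>1 = x^2 + y^2 + z^2\<close> into the moment of order
  \<open>2 * k\<close> expresses it through the next even moment \<open>m\<close> as
  \<open>m + 2 * m / (2 * k + 1)\<close>, since the second and third coordinates contribute
  equally.\<close>

lemma even_moment: "(\<integral>u. (u$1) ^ (2 * k) \<partial>N) = 1 / (2 * k + 1)"
proof (induction k)
  case 0
  then show ?case by (simp add: prob_space)
next
  case (Suc k)
  let ?m = "\<integral>u. (u$1) ^ (2 * k + 2) \<partial>N"
  have "orthonormal (axis 1 1) (axis 3 1)" by (auto simp: orthonormal_def inner_axis_axis)
  from integral_joint[OF this, of "\<lambda>(x, y). x ^ (2 * k) * y\<^sup>2"]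
  have 3: "(\<integral>u. (u$1) ^ (2 * k) * (u$3)\<^sup>2 \<partial>N) = (\<integral>u. (u$1) ^ (2 * k) * (u$2)\<^sup>2 \<partial>N)"
    by (simp add: inner_axis' flip: borel_prod)
  have "(\<integral>u. (u$1) ^ (2 * k) \<partial>N)
      = (\<integral>u. (u$1) ^ (2 * k) * (u$1)\<^sup>2 + (u$1) ^ (2 * k) * (u$2)\<^sup>2 + (u$1) ^ (2 * k) * (u$3)\<^sup>2 \<partial>N)"
  proof (rule integral_cong_AE)
    show "AE u in N. (u$1) ^ (2 * k) = (u$1) ^ (2 * k) * (u$1)\<^sup>2 + (u$1) ^ (2 * k) * (u$2)\<^sup>2
        + (u$1) ^ (2 * k) * (u$3)\<^sup>2"
      using norm_1
    proof eventually_elim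
      fix u :: "real^3" assume "norm u = 1"
      then have "(u$1)\<^sup>2 + (u$2)\<^sup>2 + (u$3)\<^sup>2 = 1" unfolding norm_eq_1 inner_3 by (simp only: power2_eq_square)
      then show "(u$1) ^ (2 * k) = (u$1) ^ (2 * k) * (u$1)\<^sup>2 + (u$1) ^ (2 * k) * (u$2)\<^sup>2
        + (u$1) ^ (2 * k) * (u$3)\<^sup>2" by (simp only: distrib_left[symmetric] mult_1_right)
    qed
  qed simp_all
  also have "\<dots> = (\<integral>u. (u$1) ^ (2 * k) * (u$1)\<^sup>2 \<partial>N)
      + (\<integral>u. (u$1) ^ (2 * k) * (u$2)\<^sup>2 \<partial>N) + (\<integral>u. (u$1) ^ (2 * k) * (u$3)\<^sup>2 \<partial>N)"
    by (simp only: Bochner_Integration.integral_add Bochner_Integration.integrable_add integrable_monomial)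
  also have "\<dots> = ?m + 2 * (?m / (2 * k + 1))"
    unfolding 3 moment_mixed[of k, symmetric] power_add[symmetric] by (simp add: field_simps)
  finally have "?m * ((2 * k + 3) / (2 * k + 1)) = 1 / (2 * k + 1)"
    unfolding Suc by (simp add: field_simps)
  then have "?m = 1 / (2 * k + 3)" by (simp add: field_simps)
  moreover have "2 * k + 2 = 2 * Suc k" "real (2 * k + 3) = 2 * real (Suc k) + 1" by simp_all
  ultimately show ?case by (simp only:)
qed

text \<open>The coordinates along \<open>- axis 1 1\<close> and \<open>axis 1 1\<close> have the
  same law, so that law is symmetric.\<close>

lemma odd_moment:
  assumes "odd k"
  shows "(\<integral>u. (u$1) ^ k \<partial>N) = 0"
  using integral_single[of "- axis 1 1" "\<lambda>x. x ^ k"] assms by (simp add: inner_axis')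

text \<open>Archimedes' hat-box theorem.\<close>

lemma distr_inner:
  assumes n: "norm n = 1"
  shows "distr N borel (\<lambda>u. n \<bullet> u) = unif"
proof (rule bounded_moments_determine)
  show "real_distribution (distr N borel (\<lambda>u. n \<bullet> u))"
    by (simp add: real_distribution_distr)
  show "AE x in distr N borel (\<lambda>u. n \<bullet> u). \<bar>x\<bar> \<le> 1"
  proof (subst AE_distr_iff)
    show "AE u in N. \<bar>n \<bullet> u\<bar> \<le> 1"
      using norm_1 by eventually_elim (metis Cauchy_Schwarz_ineq2 n mult_1)
  qed auto
  fix k
  have "(\<integral>x. x ^ k \<partial>distr N borel (\<lambda>u. n \<bullet> u)) = (\<integral>u. (u$1) ^ k \<partial>N)"
    using integral_single[OF n, of "\<lambda>x. x ^ k"] by (simp add: integral_distr)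
  also have "\<dots> = (\<integral>x. x ^ k \<partial>unif)"
  proof (cases "even k")
    case True
    then obtain j where "k = 2 * j" by blast
    then show ?thesis using even_moment[of j] by (simp add: uniform_moment field_simps)
  next
    case False
    then show ?thesis using odd_moment[of k] by (simp add: uniform_moment)
  qed
  finally show "(\<integral>x. x ^ k \<partial>distr N borel (\<lambda>u. n \<bullet> u)) = (\<integral>x. x ^ k \<partial>unif)" .
qed (simp_all add: real_distribution_unif AE_unif)

end

subsection \<open>Spherical sectors\<close>

text \<open>The clipping makes the function continuous, and it yields the half-angle of the arc
  \<open>{t. x < cos t}\<close> also when that arc is empty.\<close>

definition half_arc :: "real \<Rightarrow> real" where
  "half_arc x = arccos (max (-1) (min 1 x))"

lemma half_arc_eq_arccos: "-1 \<le> x \<Longrightarrow> x \<le> 1 \<Longrightarrow> half_arc x = arccos x"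
  by (simp add: half_arc_def)

lemma half_arc_ge_1: "1 \<le> x \<Longrightarrow> half_arc x = 0"
  by (simp add: half_arc_def)

lemma half_arc_bounds: "0 \<le> half_arc x" "half_arc x \<le> pi"
  by (auto simp: half_arc_def arccos_lbound arccos_ubound)

lemma borel_measurable_half_arc [measurable]: "half_arc \<in> borel_measurable borel"
  unfolding half_arc_def
  by (intro borel_measurable_continuous_onI continuous_intros) auto

text \<open>After substitution the window is \<open>{-a..<T - a}\<close>; its part below 0 is moved
  up by one period and fills the gap \<open>{T - a..<T}\<close>. With half-open windows the two
  pieces fit without overlap.\<close>

lemma nn_integral_periodic_shift:
  fixes P :: "real \<Rightarrow> ennreal"
  assumes [measurable]: "P \<in> borel_measurable borel"
    and per: "\<And>x. P (x - T) = P x" and a: "0 \<le> a" "a \<le> T"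
  shows "(\<integral>\<^sup>+ x. indicator {0..<T} x * P (x - a) \<partial>lborel) = (\<integral>\<^sup>+ x. indicator {0..<T} x * P x \<partial>lborel)"
proof -
  have "(\<integral>\<^sup>+ x. indicator {0..<T} x * P (x - a) \<partial>lborel)
      = (\<integral>\<^sup>+ x. indicator {0..<T} (x + a) * P x \<partial>lborel)"
    by (subst nn_integral_real_affine[where c = 1 and t = a]) (auto simp: add.commute)
  also have "\<dots> = (\<integral>\<^sup>+ x. indicator {-a..<0} x * P x + indicator {0..<T - a} x * P x \<partial>lborel)"
    using a by (intro nn_integral_cong) (auto split: split_indicator)
  also have "\<dots> = (\<integral>\<^sup>+ x. indicator {-a..<0} x * P x \<partial>lborel) + (\<integral>\<^sup>+ x. indicator {0..<T - a} x * P x \<partial>lborel)"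
    by (rule nn_integral_add) auto
  also have "(\<integral>\<^sup>+ x. indicator {-a..<0} x * P x \<partial>lborel) = (\<integral>\<^sup>+ x. indicator {-a..<0} (x - T) * P (x - T) \<partial>lborel)"
    by (subst nn_integral_real_affine[where c = 1 and t = "-T"]) auto
  also have "\<dots> = (\<integral>\<^sup>+ x. indicator {T - a..<T} x * P x \<partial>lborel)"
    by (intro nn_integral_cong) (auto simp: per split: split_indicator)
  also have "\<dots> + (\<integral>\<^sup>+ x. indicator {0..<T - a} x * P x \<partial>lborel)
      = (\<integral>\<^sup>+ x. indicator {T - a..<T} x * P x + indicator {0..<T - a} x * P x \<partial>lborel)"
    by (rule nn_integral_add[symmetric]) auto
  also have "\<dots> = (\<integral>\<^sup>+ x. indicator {0..<T} x * P x \<partial>lborel)"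
    using a by (intro nn_integral_cong) (auto split: split_indicator)
  finally show ?thesis .
qed

lemma nn_integral_arc:
  fixes x a :: real
  assumes x: "0 \<le> x" and a: "0 \<le> a" "a \<le> 2 * pi"
  shows "(\<integral>\<^sup>+ t. indicator {0..<2 * pi} t * indicator {t. x < cos (t - a)} t \<partial>lborel)
     = ennreal (2 * half_arc x)"
proof -
  define P :: "real \<Rightarrow> ennreal" where "P = indicator {t. x < cos t}"
  have [measurable]: "P \<in> borel_measurable borel" unfolding P_def by measurable
  have per: "P (t - 2 * pi) = P t" for t
    by (simp add: P_def indicator_def cos_diff)
  define b where "b = half_arc x"
  have b: "0 \<le> b" "b \<le> pi" by (auto simp: b_def half_arc_bounds)
  have cosb: "cos b = min 1 x" using x by (simp add: b_def half_arc_def max_def)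
  have "x < cos t \<longleftrightarrow> \<bar>t\<bar> < b" if t: "\<bar>t\<bar> \<le> pi" for t
  proof -
    have "\<bar>t\<bar> < b \<longleftrightarrow> cos b < cos \<bar>t\<bar>"
      using b t by (subst cos_mono_less_eq) auto
    also have "\<dots> \<longleftrightarrow> x < cos t"
      using cos_le_one[of t] by (auto simp: cosb min_def simp del: cos_le_one)
    finally show ?thesis by simp
  qed
  then have eq: "x < cos t \<longleftrightarrow> -b < t \<and> t < b" if "-pi \<le> t" "t \<le> pi" for t
    using that by (metis abs_le_iff abs_less_iff minus_le_iff minus_less_iff)
  have "(\<integral>\<^sup>+ t. indicator {0..<2 * pi} t * indicator {t. x < cos (t - a)} t \<partial>lborel)
      = (\<integral>\<^sup>+ t. indicator {0..<2 * pi} t * P (t - a) \<partial>lborel)"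
    by (simp add: P_def indicator_def)
  \<comment> \<open>The centre \<open>pi\<close> is the middle of the window, and
    \<open>b \<le> pi\<close>, so in this position the arc does not wrap around.\<close>
  also have "\<dots> = (\<integral>\<^sup>+ t. indicator {0..<2 * pi} t * P (t - pi) \<partial>lborel)"
    using nn_integral_periodic_shift[of P "2 * pi" a] nn_integral_periodic_shift[of P "2 * pi" pi] a
    by (simp add: per)
  also have "\<dots> = (\<integral>\<^sup>+ t. indicator {0..<2 * pi} (t + pi) * P t \<partial>lborel)"
    by (subst nn_integral_real_affine[where c = 1 and t = pi]) (auto simp: add.commute)
  also have "\<dots> = (\<integral>\<^sup>+ t. indicator {-b<..<b} t \<partial>lborel)"
    using b by (intro nn_integral_cong) (auto simp: P_def eq split: split_indicator)
  also have "\<dots> = ennreal (2 * b)" using b by simp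
  finally show ?thesis by (simp add: b_def)
qed

context rotation_invariant begin

text \<open>A double count of pairs of an angle \<open>t\<close> and a direction \<open>u\<close>.
  All sets \<open>A t\<close> have equal measure by invariance, which gives the left side. For fixed
  \<open>u\<close> the admissible angles form an arc whose length depends only on the height
  \<open>n \<bullet> u\<close>; the factor 2 in that length cancels against the density 1/2 of the
  height.\<close>

lemma emeasure_sector:
  assumes np: "orthonormal n p" and c: "0 \<le> c" and S [measurable]: "S \<in> sets borel" and S01: "S \<subseteq> {0<..<1}"
  shows "ennreal (2 * pi) * emeasure N {u. n \<bullet> u \<in> S \<and> c * (n \<bullet> u) < p \<bullet> u}
     = (\<integral>\<^sup>+ z. ennreal (indicator S z * half_arc (c * z / sqrt (1 - z\<^sup>2))) \<partial>lborel)"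
proof -
  interpret pair_sigma_finite lborel N by unfold_locales
  define q where "q = n \<times> p"
  define g where "g z = half_arc (c * z / sqrt (1 - z\<^sup>2))" for z
  have [measurable]: "g \<in> borel_measurable borel" unfolding g_def by measurable
  \<comment> \<open>\<open>A 0\<close> is the sector in question; \<open>A t\<close> uses the vector
    \<open>p\<close> turned about \<open>n\<close> by the angle \<open>t\<close>.\<close>
  define A where "A = (\<lambda>t. {u. n \<bullet> u \<in> S \<and> c * (n \<bullet> u) < cos t * (p \<bullet> u) + sin t * (q \<bullet> u)})"
  define e where "e = emeasure N (A 0)"
  have A_emeasure: "emeasure N (A t) = e" for t
  proof -
    let ?R = "{(x, y). x \<in> S \<and> c * x < y}"
    have "{x \<in> space (borel \<Otimes>\<^sub>M borel). fst x \<in> S \<and> c * fst x < snd x} \<in> sets (borel \<Otimes>\<^sub>M borel)"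
      by measurable
    also have "{x \<in> space (borel \<Otimes>\<^sub>M borel). fst x \<in> S \<and> c * fst x < snd x} = ?R"
      by (auto simp: space_pair_measure)
    finally have [measurable]: "?R \<in> sets borel" unfolding borel_prod .
    have n1: "norm n = 1" "n \<bullet> n = 1" "p \<bullet> p = 1" "n \<bullet> p = 0" "p \<bullet> n = 0"
      using np by (auto simp: orthonormal_def norm_eq_1 inner_commute)
    have q: "q \<bullet> q = 1" "q \<bullet> p = 0" "p \<bullet> q = 0" "n \<bullet> q = 0"
      using norm_cross_dot[of n p] np n1
      by (simp_all add: orthonormal_def power2_norm_eq_inner q_def dot_cross_self)
    have "orthonormal n (cos t *\<^sub>R p + sin t *\<^sub>R q)"
      using n1 q by (simp add: orthonormal_def norm_eq_1 inner_simps flip: power2_eq_square)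
    then have eq: "distr N borel (\<lambda>u. (n \<bullet> u, (cos t *\<^sub>R p + sin t *\<^sub>R q) \<bullet> u)) = distr N borel (\<lambda>u. (n \<bullet> u, p \<bullet> u))"
      using np by (simp only: distr_joint)
    have "emeasure N (A t) = emeasure (distr N borel (\<lambda>u. (n \<bullet> u, (cos t *\<^sub>R p + sin t *\<^sub>R q) \<bullet> u))) ?R"
      by (subst emeasure_distr)
         (auto simp: A_def measurable_pair inner_simps sets_eq_imp_space_eq[OF sets_N] intro!: arg_cong[where f = "emeasure N"])
    also have "\<dots> = emeasure N (A 0)"
      unfolding eq
      by (subst emeasure_distr)
         (auto simp: A_def measurable_pair inner_simps sets_eq_imp_space_eq[OF sets_N] intro!: arg_cong[where f = "emeasure N"])
    finally show ?thesis unfolding e_def .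
  qed
  have [measurable]: "A t \<in> sets N" for t
  proof -
    have "{u \<in> space N. n \<bullet> u \<in> S \<and> c * (n \<bullet> u) < cos t * (p \<bullet> u) + sin t * (q \<bullet> u)} \<in> sets N"
      by measurable
    then show ?thesis by (simp add: A_def sets_eq_imp_space_eq[OF sets_N])
  qed
  have [measurable]: "(\<lambda>(t, u). indicator (A t) u :: ennreal) \<in> borel_measurable (lborel \<Otimes>\<^sub>M N)"
    unfolding A_def indicator_def mem_Collect_eq by measurable
  have "ennreal (2 * pi) * e = (\<integral>\<^sup>+ t. indicator {0..<2 * pi} t * emeasure N (A t) \<partial>lborel)"
    unfolding A_emeasure by (subst nn_integral_multc) auto
  also have "\<dots> = (\<integral>\<^sup>+ t. (\<integral>\<^sup>+ u. indicator {0..<2 * pi} t * indicator (A t) u \<partial>N) \<partial>lborel)"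
    by (intro nn_integral_cong nn_integral_cmult_indicator[symmetric]) measurable
  also have "\<dots> = (\<integral>\<^sup>+ u. (\<integral>\<^sup>+ t. indicator {0..<2 * pi} t * indicator (A t) u \<partial>lborel) \<partial>N)"
    by (rule Fubini'[symmetric]) measurable
  also have "\<dots> = (\<integral>\<^sup>+ u. ennreal (2 * (indicator S (n \<bullet> u) * g (n \<bullet> u))) \<partial>N)"
  proof (rule nn_integral_cong_AE)
    show "AE u in N. (\<integral>\<^sup>+ t. indicator {0..<2 * pi} t * indicator (A t) u \<partial>lborel)
        = ennreal (2 * (indicator S (n \<bullet> u) * g (n \<bullet> u)))"
      using norm_1
    proof eventually_elim
      fix u :: "real^3" assume u: "norm u = 1"
      show "(\<integral>\<^sup>+ t. indicator {0..<2 * pi} t * indicator (A t) u \<partial>lborel)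
        = ennreal (2 * (indicator S (n \<bullet> u) * g (n \<bullet> u)))"
      proof (cases "n \<bullet> u \<in> S")
        case False
        then show ?thesis by (simp add: A_def)
      next
        case True
        \<comment> \<open>\<open>r\<close> is the radius of the circle of latitude at height
          \<open>z\<close>, and the angle \<open>a\<close> obtained below is the position of
          \<open>u\<close> on that circle.\<close>
        define z r where "z = n \<bullet> u" and "r = sqrt (1 - z\<^sup>2)"
        have z: "0 < z" "z < 1" using S01 True by (auto simp: z_def)
        then have "z\<^sup>2 < 1" by (simp add: power_less_one_iff abs_square_less_1)
        then have r: "r > 0" "r\<^sup>2 = 1 - z\<^sup>2" by (simp_all add: r_def)
        have "(p \<bullet> u)\<^sup>2 + (q \<bullet> u)\<^sup>2 = r\<^sup>2"
          using frame_parseval[OF np, of u] by (simp add: u r z_def q_def)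
        then have "(p \<bullet> u / r)\<^sup>2 + (q \<bullet> u / r)\<^sup>2 = 1"
          using r(1) by (simp add: power_divide flip: add_divide_distrib)
        from sincos_total_2pi_le[OF this] obtain a where a: "0 \<le> a" "a \<le> 2 * pi"
          "p \<bullet> u / r = cos a" "q \<bullet> u / r = sin a" by blast
        then have pq: "p \<bullet> u = r * cos a" "q \<bullet> u = r * sin a" using r(1) by (auto simp: field_simps)
        have "u \<in> A t \<longleftrightarrow> c * z / r < cos (t - a)" for t
        proof -
          have "u \<in> A t \<longleftrightarrow> c * z < r * cos (t - a)"
            using True by (simp add: A_def z_def pq cos_diff algebra_simps)
          then show ?thesis using r(1) by (simp add: field_simps)
        qed
        then have "(\<integral>\<^sup>+ t. indicator {0..<2 * pi} t * indicator (A t) u \<partial>lborel)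
            = (\<integral>\<^sup>+ t. indicator {0..<2 * pi} t * indicator {t. c * z / r < cos (t - a)} t \<partial>lborel)"
          by (intro nn_integral_cong) (simp add: indicator_def)
        also have "\<dots> = ennreal (2 * half_arc (c * z / r))"
          using c z r a by (intro nn_integral_arc) auto
        finally show ?thesis using True by (simp add: g_def r_def z_def)
      qed
    qed
  qed
  also have "\<dots> = (\<integral>\<^sup>+ z. ennreal (2 * (indicator S z * g z)) \<partial>distr N borel (\<lambda>u. n \<bullet> u))"
    by (subst nn_integral_distr) auto
  also have "\<dots> = (\<integral>\<^sup>+ z. ennreal (indicator {-1..1} z / 2) * ennreal (2 * (indicator S z * g z)) \<partial>lborel)"
    using np unfolding orthonormal_def
    by (subst distr_inner) (simp_all add: unif_def nn_integral_density)
  also have "\<dots> = (\<integral>\<^sup>+ z. ennreal (indicator S z * g z) \<partial>lborel)"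
  proof (intro nn_integral_cong)
    fix z :: real
    show "ennreal (indicator {-1..1} z / 2) * ennreal (2 * (indicator S z * g z)) = ennreal (indicator S z * g z)"
      using S01 by (auto split: split_indicator simp flip: ennreal_mult')
  qed
  finally show ?thesis by (simp add: e_def A_def g_def)
qed

end

subsection \<open>Areas of projected tetrahedra\<close>

text \<open>The determinant of \<open>x\<close> and \<open>y\<close>: twice the signed area of the
  triangle with vertices \<open>0\<close>, \<open>x\<close>, \<open>y\<close>.\<close>

definition area_form :: "real^2 \<Rightarrow> real^2 \<Rightarrow> real" where
  "area_form x y = x $ 1 * y $ 2 - x $ 2 * y $ 1"

lemma measure_triangle:
  fixes a b c :: "real^2"
  shows "measure lebesgue (convex hull {a, b, c}) = \<bar>area_form (b - a) (c - a)\<bar> / 2"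
proof -
  have "compact (convex hull {a, b, c})" by (simp add: finite_imp_compact_convex_hull)
  then have "measure lebesgue (convex hull {a, b, c}) = measure lborel (convex hull {a, b, c})"
    by (intro measure_completion) (simp add: compact_imp_closed borel_closed)
  also have "\<dots> = \<bar>area_form (b - a) (c - a)\<bar> / 2"
    unfolding content_triangle by (simp add: area_form_def algebra_simps abs_minus_commute)
  finally show ?thesis .
qed

text \<open>The diagonal from \<open>a\<close> to \<open>b\<close> splits the quadrilateral. In a
  convex combination, weight on \<open>c\<close> and \<open>d\<close> in the ratio
  \<open>1 - s\<close> to \<open>s\<close> can be moved to the crossing point and from there to
  \<open>a\<close> and \<open>b\<close>. Moving as much as possible uses up \<open>c\<close> or
  \<open>d\<close>, whichever is scarcer in this ratio. The auxiliary fact treats \<open>d\<close>;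
  exchanging \<open>c\<close> with \<open>d\<close> and \<open>s\<close> with \<open>1 - s\<close>
  gives the other case.\<close>

lemma hull_crossing:
  fixes a b c d :: "'a::real_vector"
  assumes s: "0 \<le> s" "s \<le> 1" and t: "0 \<le> t" "t \<le> 1"
    and x: "(1 - t) *\<^sub>R a + t *\<^sub>R b = (1 - s) *\<^sub>R c + s *\<^sub>R d"
  shows "convex hull {a, b, c, d} = convex hull {a, b, c} \<union> convex hull {a, b, d}" (is "?H = ?C \<union> ?D")
proof
  show "?C \<union> ?D \<subseteq> ?H" by (intro Un_least hull_mono) auto
  have *: "y \<in> convex hull {a, b, c}"
    if y: "y = \<alpha> *\<^sub>R a + \<beta> *\<^sub>R b + \<gamma> *\<^sub>R c + \<epsilon> *\<^sub>R d"
      and nn: "0 \<le> \<alpha>" "0 \<le> \<beta>" "0 \<le> \<gamma>" "0 \<le> \<epsilon>" "\<alpha> + \<beta> + \<gamma> + \<epsilon> = 1"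
      and le: "\<epsilon> * (1 - s) \<le> \<gamma> * s"
      and s: "0 \<le> s" "s \<le> 1" and x: "(1 - t) *\<^sub>R a + t *\<^sub>R b = (1 - s) *\<^sub>R c + s *\<^sub>R d"
    for y :: 'a and c d \<alpha> \<beta> \<gamma> \<epsilon> s
  proof (cases "s = 0")
    case True
    then have "\<epsilon> = 0" using le nn by auto
    then show ?thesis unfolding convex_hull_3 using y nn by fastforce
  next
    case False
    \<comment> \<open>\<open>k\<close> is the weight placed on the crossing point so that all of
      \<open>d\<close> is absorbed.\<close>
    define k where "k = \<epsilon> / s"
    have k: "0 \<le> k" "\<epsilon> = k * s" "k * (1 - s) \<le> \<gamma>"
      using False s nn le by (auto simp: k_def field_simps)
    have "y = \<alpha> *\<^sub>R a + \<beta> *\<^sub>R b + (\<gamma> - k * (1 - s)) *\<^sub>R c + k *\<^sub>R ((1 - s) *\<^sub>R c + s *\<^sub>R d)"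
      by (simp add: y k(2) algebra_simps)
    also have "\<dots> = (\<alpha> + k * (1 - t)) *\<^sub>R a + (\<beta> + k * t) *\<^sub>R b + (\<gamma> - k * (1 - s)) *\<^sub>R c"
      unfolding x[symmetric] by (simp add: algebra_simps)
    finally have "y = (\<alpha> + k * (1 - t)) *\<^sub>R a + (\<beta> + k * t) *\<^sub>R b + (\<gamma> - k * (1 - s)) *\<^sub>R c" .
    moreover have "(\<alpha> + k * (1 - t)) + (\<beta> + k * t) + (\<gamma> - k * (1 - s)) = 1"
      using nn k by (simp add: algebra_simps)
    moreover have "0 \<le> \<alpha> + k * (1 - t)" "0 \<le> \<beta> + k * t" "0 \<le> \<gamma> - k * (1 - s)"
      using nn k t by auto
    ultimately show ?thesis unfolding convex_hull_3 by blast
  qed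
  show "?H \<subseteq> ?C \<union> ?D"
  proof
    fix y assume "y \<in> ?H"
    also have "?H = convex hull (insert d {a, b, c})" by (simp add: insert_commute)
    finally obtain v w z where vw: "0 \<le> v" "0 \<le> w" "v + w = 1" "z \<in> ?C" "y = v *\<^sub>R d + w *\<^sub>R z"
      by (subst (asm) convex_hull_insert) auto
    then obtain \<alpha> \<beta> \<gamma> where z: "0 \<le> \<alpha>" "0 \<le> \<beta>" "0 \<le> \<gamma>" "\<alpha> + \<beta> + \<gamma> = 1" "z = \<alpha> *\<^sub>R a + \<beta> *\<^sub>R b + \<gamma> *\<^sub>R c"
      unfolding convex_hull_3 by auto
    have y: "y = (w * \<alpha>) *\<^sub>R a + (w * \<beta>) *\<^sub>R b + (w * \<gamma>) *\<^sub>R c + v *\<^sub>R d"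
      using vw z by (simp add: algebra_simps)
    have sum: "w * \<alpha> + w * \<beta> + w * \<gamma> + v = 1"
      using vw z(4) by (simp flip: distrib_left)
    show "y \<in> ?C \<union> ?D"
    proof (cases "v * (1 - s) \<le> w * \<gamma> * s")
      case True
      have "y \<in> ?C" by (rule *[OF y _ _ _ _ sum True s x]) (use vw z in auto)
      then show ?thesis ..
    next
      case False
      have y': "y = (w * \<alpha>) *\<^sub>R a + (w * \<beta>) *\<^sub>R b + v *\<^sub>R d + (w * \<gamma>) *\<^sub>R c"
        using y by (simp only: add_ac)
      have sum': "w * \<alpha> + w * \<beta> + v + w * \<gamma> = 1" using sum by (simp only: add_ac)
      have le': "w * \<gamma> * (1 - (1 - s)) \<le> v * (1 - s)" using False by simp
      have x': "(1 - t) *\<^sub>R a + t *\<^sub>R b = (1 - (1 - s)) *\<^sub>R d + (1 - s) *\<^sub>R c"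
        using x by simp
      have "y \<in> ?D"
        by (rule *[OF y' _ _ _ _ sum' le' _ _ x']) (use s vw z in simp_all)
      then show ?thesis ..
    qed
  qed
qed

text \<open>The two triangles lie on opposite sides of the line through \<open>a\<close> and
  \<open>b\<close>, so they share at most a part of that line. The side is the sign of
  \<open>D\<close>, and the crossing forces \<open>D c\<close> and \<open>D d\<close> to be of
  opposite sign unless one of the triangles is degenerate.\<close>

lemma measure_crossing:
  fixes a b c d :: "real^2"
  assumes s: "0 \<le> s" "s \<le> 1" and t: "0 \<le> t" "t \<le> 1"
    and x: "(1 - t) *\<^sub>R a + t *\<^sub>R b = (1 - s) *\<^sub>R c + s *\<^sub>R d"
  shows "measure lebesgue (convex hull {a, b, c, d})
    = measure lebesgue (convex hull {a, b, c}) + measure lebesgue (convex hull {a, b, d})"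
    (is "_ = measure lebesgue ?C + measure lebesgue ?D")
proof -
  have lm: "?C \<in> lmeasurable" "?D \<in> lmeasurable"
    by (simp_all add: lmeasurable_compact finite_imp_compact_convex_hull)
  define D where "D y = area_form (b - a) (y - a)" for y
  have D_comb: "D (\<alpha> *\<^sub>R a + \<beta> *\<^sub>R b + \<gamma> *\<^sub>R e) = \<gamma> * D e" if "\<alpha> + \<beta> + \<gamma> = 1" for \<alpha> \<beta> \<gamma> e
  proof -
    have "\<alpha> = 1 - \<beta> - \<gamma>" using that by simp
    show ?thesis unfolding \<open>\<alpha> = 1 - \<beta> - \<gamma>\<close> by (simp add: D_def area_form_def algebra_simps)
  qed
  have Dx: "(1 - s) * D c + s * D d = 0"
  proof -
    have "D ((1 - s) *\<^sub>R c + s *\<^sub>R d) = (1 - s) * D c + s * D d"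
      by (simp add: D_def area_form_def algebra_simps)
    moreover have "D ((1 - t) *\<^sub>R a + t *\<^sub>R b) = 0"
      using D_comb[of "1 - t" t 0 c] by simp
    ultimately show ?thesis by (simp add: x)
  qed
  have mC: "measure lebesgue ?C = \<bar>D c\<bar> / 2" and mD: "measure lebesgue ?D = \<bar>D d\<bar> / 2"
    by (simp_all add: measure_triangle D_def)
  have "measure lebesgue (?C \<inter> ?D) = 0"
  proof (cases "D c = 0 \<or> D d = 0")
    case True
    then have "measure lebesgue ?C = 0 \<or> measure lebesgue ?D = 0" by (auto simp: mC mD)
    moreover have "measure lebesgue (?C \<inter> ?D) \<le> measure lebesgue ?C" "measure lebesgue (?C \<inter> ?D) \<le> measure lebesgue ?D"
      using lm by (auto intro!: measure_mono_fmeasurable simp: fmeasurableD)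
    ultimately show ?thesis using measure_nonneg[of lebesgue "?C \<inter> ?D"] by linarith
  next
    case False
    then have "s \<noteq> 0" "s \<noteq> 1" using Dx by auto
    then have s': "0 < s" "s < 1" using s by auto
    have opp: "D c * D d < 0"
    proof -
      have "(1 - s) * D c = - (s * D d)" using Dx by (rule eq_neg_iff_add_eq_0[THEN iffD2])
      then have "(1 - s) * (D c * D d) = - (s * (D d)\<^sup>2)"
        by (simp only: mult.assoc[symmetric] power2_eq_square mult_minus_left)
      also have "\<dots> < 0" using s' False by simp
      finally show ?thesis using s' by (simp add: mult_less_0_iff)
    qed
    have "D y = 0" if yCD: "y \<in> ?C \<inter> ?D" for y
    proof -
      obtain \<gamma> where 1: "0 \<le> \<gamma>" "D y = \<gamma> * D c"
      proof -
        obtain \<alpha> \<beta> \<gamma> where "0 \<le> \<gamma>" "\<alpha> + \<beta> + \<gamma> = 1" "y = \<alpha> *\<^sub>R a + \<beta> *\<^sub>R b + \<gamma> *\<^sub>R c"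
          using yCD unfolding convex_hull_3 by auto
        then show thesis using D_comb[of \<alpha> \<beta> \<gamma> c] by (intro that) auto
      qed
      obtain \<epsilon> where 2: "0 \<le> \<epsilon>" "D y = \<epsilon> * D d"
      proof -
        obtain \<alpha> \<beta> \<gamma> where "0 \<le> \<gamma>" "\<alpha> + \<beta> + \<gamma> = 1" "y = \<alpha> *\<^sub>R a + \<beta> *\<^sub>R b + \<gamma> *\<^sub>R d"
          using yCD unfolding convex_hull_3 by auto
        then show thesis using D_comb[of \<alpha> \<beta> \<gamma> d] by (intro that) auto
      qed
      have "(D y)\<^sup>2 = (\<gamma> * \<epsilon>) * (D c * D d)" using 1(2) 2(2) by (simp add: power2_eq_square)
      also have "\<dots> \<le> 0" using opp 1(1) 2(1) by (intro mult_nonneg_nonpos[OF mult_nonneg_nonneg]) simp_all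
      finally show ?thesis by simp
    qed
    \<comment> \<open>\<open>w\<close> is a normal of the line through \<open>a\<close> and
      \<open>b\<close>, which turns \<open>D y = 0\<close> into the equation of a
      hyperplane.\<close>
    moreover define w :: "real^2" where "w = vector [- (b - a) $ 2, (b - a) $ 1]"
    have Dw: "D y = w \<bullet> y - w \<bullet> a" for y
      by (simp add: D_def area_form_def w_def inner_vec_def sum_2 algebra_simps)
    ultimately have "?C \<inter> ?D \<subseteq> {y. w \<bullet> y = w \<bullet> a}" by auto
    moreover have "w \<noteq> 0" using False Dw by auto
    ultimately have "negligible (?C \<inter> ?D)"
      using negligible_hyperplane negligible_subset by blast
    then show ?thesis by (simp add: negligible_iff_measure)
  qed
  then show ?thesis
    unfolding hull_crossing[OF assms] using measure_Un3[OF lm] by simp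
qed

text \<open>The sorted coefficients of an affine dependence tell whether one point lies in the triangle
  of the others or the segments \<open>q1 q2\<close> and \<open>q3 q4\<close> cross.\<close>

lemma measure_hull_4:
  fixes q1 q2 q3 q4 :: "real^2" and h1 h2 h3 h4 k :: real
  assumes sum: "h1 + h2 + h3 + h4 = 0"
    and dep: "h1 *\<^sub>R q1 + h2 *\<^sub>R q2 + h3 *\<^sub>R q3 + h4 *\<^sub>R q4 = 0"
    and ord: "h1 \<ge> h2" "h2 \<ge> h3" "h3 \<ge> h4" and nz: "h1 \<noteq> 0"
    and area: "measure lebesgue (convex hull {q2, q3, q4}) = k * \<bar>h1\<bar>"
      "measure lebesgue (convex hull {q1, q2, q4}) = k * \<bar>h3\<bar>"
      "measure lebesgue (convex hull {q1, q2, q3}) = k * \<bar>h4\<bar>"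
  shows "measure lebesgue (convex hull {q1, q2, q3, q4}) = k * (\<bar>h1\<bar> + \<bar>h2\<bar> + \<bar>h3\<bar> + \<bar>h4\<bar>) / 2"
proof -
  have h: "h1 > 0" "h4 < 0" using sum ord nz by linarith+
  \<comment> \<open>In all three cases the positive and the negative coefficients have equal
    absolute sums, so half of the total is \<open>\<bar>h1\<bar>\<close>,
    \<open>\<bar>h3\<bar> + \<bar>h4\<bar>\<close> or \<open>\<bar>h4\<bar>\<close>, as the
    surviving triangles require.\<close>
  consider "h2 < 0" | "h2 \<ge> 0" "h3 \<le> 0" | "h3 > 0" by linarith
  then show ?thesis
  proof cases
    case 1
    have "h1 *\<^sub>R q1 = h1 *\<^sub>R q1 - (h1 *\<^sub>R q1 + h2 *\<^sub>R q2 + h3 *\<^sub>R q3 + h4 *\<^sub>R q4)"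
      by (simp only: dep diff_zero add_0_right)
    also have "\<dots> = (-h2) *\<^sub>R q2 + (-h3) *\<^sub>R q3 + (-h4) *\<^sub>R q4" by simp
    finally have "h1 *\<^sub>R q1 = (-h2) *\<^sub>R q2 + (-h3) *\<^sub>R q3 + (-h4) *\<^sub>R q4" .
    then have "(1/h1) *\<^sub>R h1 *\<^sub>R q1 = (-h2/h1) *\<^sub>R q2 + (-h3/h1) *\<^sub>R q3 + (-h4/h1) *\<^sub>R q4"
      by (simp add: scaleR_add_right scaleR_diff_right divide_inverse mult.commute)
    then have "q1 = (-h2/h1) *\<^sub>R q2 + (-h3/h1) *\<^sub>R q3 + (-h4/h1) *\<^sub>R q4" using h by simp
    moreover have "-h2 + -h3 + -h4 = h1" using sum by simp
    then have "-h2/h1 + -h3/h1 + -h4/h1 = 1" using h by (simp only: add_divide_distrib[symmetric]) simp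
    moreover have "0 \<le> -h2/h1" "0 \<le> -h3/h1" "0 \<le> -h4/h1"
      using h sum ord 1 by (auto simp: field_simps)
    ultimately have "q1 \<in> convex hull {q2, q3, q4}" unfolding convex_hull_3 by blast
    then have "convex hull {q1, q2, q3, q4} = convex hull {q2, q3, q4}" by (rule hull_redundant)
    moreover have "\<bar>h1\<bar> + \<bar>h2\<bar> + \<bar>h3\<bar> + \<bar>h4\<bar> = 2 * \<bar>h1\<bar>" using sum ord h 1 by simp
    ultimately show ?thesis using area(1) by simp
  next
    case 3
    have "(-h4) *\<^sub>R q4 = (-h4) *\<^sub>R q4 + (h1 *\<^sub>R q1 + h2 *\<^sub>R q2 + h3 *\<^sub>R q3 + h4 *\<^sub>R q4)"
      by (simp only: dep diff_zero add_0_right)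
    also have "\<dots> = h1 *\<^sub>R q1 + h2 *\<^sub>R q2 + h3 *\<^sub>R q3" by simp
    finally have "(-h4) *\<^sub>R q4 = h1 *\<^sub>R q1 + h2 *\<^sub>R q2 + h3 *\<^sub>R q3" .
    then have "(1/-h4) *\<^sub>R (-h4) *\<^sub>R q4 = (h1/-h4) *\<^sub>R q1 + (h2/-h4) *\<^sub>R q2 + (h3/-h4) *\<^sub>R q3"
      by (simp add: scaleR_add_right scaleR_diff_right divide_inverse mult.commute)
    then have "q4 = (h1/-h4) *\<^sub>R q1 + (h2/-h4) *\<^sub>R q2 + (h3/-h4) *\<^sub>R q3" using h by simp
    moreover have "h1 + h2 + h3 = -h4" using sum by simp
    then have "h1/-h4 + h2/-h4 + h3/-h4 = 1" using h by (simp only: add_divide_distrib[symmetric]) simp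
    moreover have "0 \<le> h1/-h4" "0 \<le> h2/-h4" "0 \<le> h3/-h4"
      using h sum ord 3 by (auto simp: field_simps)
    ultimately have "q4 \<in> convex hull {q1, q2, q3}" unfolding convex_hull_3 by blast
    then have "convex hull (insert q4 {q1, q2, q3}) = convex hull {q1, q2, q3}" by (rule hull_redundant)
    moreover have "insert q4 {q1, q2, q3} = {q1, q2, q3, q4}" by auto
    moreover have "\<bar>h1\<bar> + \<bar>h2\<bar> + \<bar>h3\<bar> + \<bar>h4\<bar> = 2 * \<bar>h4\<bar>" using sum ord h 3 by simp
    ultimately show ?thesis using area(3) by simp
  next
    case 2
    define s where "s = h1 + h2"
    have s: "s > 0" "s = -h3 - h4" using h 2 sum by (auto simp: s_def)
    have t: "h1 / s = 1 - h2 / s" "-h3 / s = 1 - -h4 / s"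
      using s by (auto simp: s_def field_simps)
    have "h1 *\<^sub>R q1 + h2 *\<^sub>R q2 = h1 *\<^sub>R q1 + h2 *\<^sub>R q2 - (h1 *\<^sub>R q1 + h2 *\<^sub>R q2 + h3 *\<^sub>R q3 + h4 *\<^sub>R q4)"
      by (simp only: dep diff_zero add_0_right)
    also have "\<dots> = (-h3) *\<^sub>R q3 + (-h4) *\<^sub>R q4" by simp
    finally have "h1 *\<^sub>R q1 + h2 *\<^sub>R q2 = (-h3) *\<^sub>R q3 + (-h4) *\<^sub>R q4" .
    then have "(1/s) *\<^sub>R (h1 *\<^sub>R q1 + h2 *\<^sub>R q2) = (1/s) *\<^sub>R ((-h3) *\<^sub>R q3 + (-h4) *\<^sub>R q4)" by simp
    then have "(h1 / s) *\<^sub>R q1 + (h2 / s) *\<^sub>R q2 = (-h3 / s) *\<^sub>R q3 + (-h4 / s) *\<^sub>R q4"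
      by (simp only: scaleR_add_right scaleR_scaleR) simp
    then have x: "(1 - h2 / s) *\<^sub>R q1 + (h2 / s) *\<^sub>R q2 = (1 - -h4 / s) *\<^sub>R q3 + (-h4 / s) *\<^sub>R q4"
      unfolding t .
    have le: "h2 \<le> s" "-h4 \<le> s" using s(2) h 2 by (simp_all add: s_def)
    then have pos: "0 \<le> -h4 / s" "-h4 / s \<le> 1" "0 \<le> h2 / s" "h2 / s \<le> 1"
      using s(1) h 2 by (simp_all only: divide_le_eq_1_pos) (simp_all add: divide_nonpos_pos)
    have "measure lebesgue (convex hull {q1, q2, q3, q4}) = k * \<bar>h4\<bar> + k * \<bar>h3\<bar>"
      unfolding measure_crossing[OF pos x] area(2,3) ..
    also have "\<dots> = k * (\<bar>h4\<bar> + \<bar>h3\<bar>)" by (rule distrib_left[symmetric])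
    also have "\<bar>h4\<bar> + \<bar>h3\<bar> = (\<bar>h1\<bar> + \<bar>h2\<bar> + \<bar>h3\<bar> + \<bar>h4\<bar>) / 2" using h 2 sum by simp
    finally show ?thesis by simp
  qed
qed

text \<open>A sign change of one coordinate permutes the four terms up to sign, so the coordinates
  may be taken nonnegative. Then the sum is four times the largest coordinate if that one exceeds
  the sum of the others, and \<open>2 * (X + Y + Z)\<close> otherwise.\<close>

lemma bt_abs_identity:
  fixes x y z :: real
  shows "\<bar>x + y + z\<bar> + \<bar>x - y - z\<bar> + \<bar>- x + y - z\<bar> + \<bar>- x - y + z\<bar>
    = 8 * max (max \<bar>x\<bar> (max \<bar>y\<bar> \<bar>z\<bar>) / 2) ((\<bar>x\<bar> + \<bar>y\<bar> + \<bar>z\<bar>) / 4)"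
proof -
  have nonneg: "(X + Y + Z) + \<bar>X - Y - Z\<bar> + \<bar>Y - X - Z\<bar> + \<bar>Z - X - Y\<bar>
    = 8 * max (max X (max Y Z) / 2) ((X + Y + Z) / 4)" if "X \<ge> 0" "Y \<ge> 0" "Z \<ge> 0" for X Y Z :: real
  proof -
    consider "X \<ge> Y + Z" | "Y \<ge> X + Z" | "Z \<ge> X + Y" | "X < Y + Z" "Y < X + Z" "Z < X + Y" by linarith
    then show ?thesis
    proof cases
      case 1
      then have "max X (max Y Z) = X" using that by simp
      then show ?thesis using 1 that by (simp add: max_absorb1)
    next
      case 2
      then have "max X (max Y Z) = Y" using that by simp
      then show ?thesis using 2 that by (simp add: max_absorb1)
    next
      case 3
      then have "max X (max Y Z) = Z" using that by simp
      then show ?thesis using 3 that by (simp add: max_absorb1)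
    next
      case 4
      then have "max X (max Y Z) / 2 \<le> (X + Y + Z) / 4" by simp
      then show ?thesis using 4 by (simp add: max_absorb2)
    qed
  qed
  have "\<bar>x + y + z\<bar> + \<bar>x - y - z\<bar> + \<bar>- x + y - z\<bar> + \<bar>- x - y + z\<bar>
    = (\<bar>x\<bar> + \<bar>y\<bar> + \<bar>z\<bar>) + \<bar>\<bar>x\<bar> - \<bar>y\<bar> - \<bar>z\<bar>\<bar> + \<bar>\<bar>y\<bar> - \<bar>x\<bar> - \<bar>z\<bar>\<bar> + \<bar>\<bar>z\<bar> - \<bar>x\<bar> - \<bar>y\<bar>\<bar>"
    by (smt (verit))
  also have "\<dots> = 8 * max (max \<bar>x\<bar> (max \<bar>y\<bar> \<bar>z\<bar>) / 2) ((\<bar>x\<bar> + \<bar>y\<bar> + \<bar>z\<bar>) / 4)"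
    by (rule nonneg) simp_all
  finally show ?thesis .
qed

section \<open>Brightness as the area of a planar convex hull\<close>

text \<open>\<open>\<pi>\<close> reads off coordinates in the plane orthogonal to \<open>u\<close>
  with respect to an orthonormal basis \<open>f\<close>, \<open>g\<close>. Since
  \<open>f \<times> g\<close> is \<open>u\<close> or \<open>- u\<close>, the area form becomes a
  triple product by the identity for \<open>(f \<times> g) \<bullet> (x \<times> y)\<close>.\<close>

lemma brightness_hull:
  assumes u: "norm u = 1"
  obtains \<pi> :: "real^3 \<Rightarrow> real^2" where "linear \<pi>" "\<pi> u = 0"
    "\<And>x y. \<bar>area_form (\<pi> x) (\<pi> y)\<bar> = \<bar>u \<bullet> (x \<times> y)\<bar>"
    "\<And>V. finite V \<Longrightarrow> brightness (convex hull V) u = measure lebesgue (convex hull (\<pi> ` V))"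
proof -
  let ?P = "{u}\<^sup>\<bottom>"
  have P: "?P = {x. u \<bullet> x = 0}" by (auto simp: orthogonal_comp_def orthogonal_def)
  have uu: "u \<bullet> u = 1" using u by (simp add: norm_eq_1)
  have "u \<noteq> 0" using u by auto
  then have "dim ?P = 2" unfolding P by (simp add: dim_hyperplane)
  then obtain L where L: "plane_isometry ?P L"
    using plane_isometry_exists subspace_orthogonal_comp by blast
  have linL: "linear L" and nL: "\<And>x. norm (L x) = norm x" and rL: "range L = ?P"
    using L by (auto simp: plane_isometry_def)
  have iL: "L x \<bullet> L y = x \<bullet> y" for x y
    unfolding dot_norm by (simp add: nL flip: linear_add[OF linL])
  define f g where "f = L (axis 1 1)" and "g = L (axis 2 1)"
  have uL: "u \<bullet> L x = 0" for x using rL P by blast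
  have fg: "orthonormal f g"
    by (simp add: orthonormal_def f_def g_def nL iL inner_axis_axis)
  have fgu: "f \<bullet> u = 0" "g \<bullet> u = 0" using uL by (simp_all add: f_def g_def inner_commute)
  define \<pi> :: "real^3 \<Rightarrow> real^2" where "\<pi> x = vector [f \<bullet> x, g \<bullet> x]" for x
  define Q where "Q x = x - (x \<bullet> u) *\<^sub>R u" for x
  have lin\<pi>: "linear \<pi>"
    by (rule linearI) (simp_all add: \<pi>_def vec_eq_iff forall_2 inner_add_right)
  have "\<bar>area_form (\<pi> x) (\<pi> y)\<bar> = \<bar>u \<bullet> (x \<times> y)\<bar>" for x y
  proof -
    have "area_form (\<pi> x) (\<pi> y) = (f \<times> g) \<bullet> (x \<times> y)"
      by (simp add: area_form_def \<pi>_def dot_cross inner_commute mult.commute)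
    then show ?thesis using frame_third[OF fg u fgu] by auto
  qed
  moreover have "\<pi> u = 0"
    by (simp add: \<pi>_def fgu vec_eq_iff forall_2)
  moreover have "brightness (convex hull V) u = measure lebesgue (convex hull (\<pi> ` V))" if "finite V" for V
  proof -
    have LQ: "L (\<pi> x) = Q x" for x
    proof -
      have "Q x \<in> ?P" by (simp add: P Q_def inner_diff_right uu inner_commute)
      then obtain y where y: "Q x = L y" using rL by blast
      have "y $ 1 = f \<bullet> x" "y $ 2 = g \<bullet> x"
        using iL[of "axis 1 1" y] iL[of "axis 2 1" y] fgu
        by (simp_all add: f_def[symmetric] g_def[symmetric] y[symmetric] Q_def inner_diff_right inner_axis')
      then have "\<pi> x = y" by (simp add: \<pi>_def vec_eq_iff forall_2)
      then show ?thesis using y by simp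
    qed
    have "compact (convex hull V)" using that by (rule finite_imp_compact_convex_hull)
    moreover have "continuous_on (convex hull V) Q"
      unfolding Q_def by (intro continuous_intros)
    ultimately have "compact (Q ` (convex hull V))" by (rule compact_continuous_image[rotated])
    then have "brightness (convex hull V) u = measure lebesgue (L -` Q ` (convex hull V))"
      unfolding brightness_def Q_def[symmetric] by (rule plane_area_eq[OF L])
    also have "L -` Q ` (convex hull V) = \<pi> ` (convex hull V)"
      using plane_isometry_inj[OF L] by (auto simp: LQ[symmetric] inj_eq)
    also have "\<dots> = convex hull (\<pi> ` V)"
      using lin\<pi> by (rule convex_hull_linear_image)
    finally show ?thesis .
  qed
  ultimately show thesis using lin\<pi> that by blast
qed

section \<open>Frame, faces and brightness of the regular tetrahedron\<close>

definition tetra :: "real^3 \<Rightarrow> real^3 \<Rightarrow> real^3 \<Rightarrow> real^3 \<Rightarrow> bool" where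
  "tetra p1 p2 p3 p4 \<longleftrightarrow> dist p1 p2 = 1 \<and> dist p1 p3 = 1 \<and> dist p1 p4 = 1
     \<and> dist p2 p3 = 1 \<and> dist p2 p4 = 1 \<and> dist p3 p4 = 1"

definition centroid :: "real^3 \<Rightarrow> real^3 \<Rightarrow> real^3 \<Rightarrow> real^3 \<Rightarrow> real^3" where
  "centroid p1 p2 p3 p4 = (p1 + p2 + p3 + p4) /\<^sub>R 4"

text \<open>The frame consists of the bimedian directions of the tetrahedron.\<close>

lemma tetra_frame:
  assumes "tetra p1 p2 p3 p4"
  obtains e1 e2 e3 where "orthonormal e1 e2" "e3 = e1 \<times> e2 \<or> e3 = - (e1 \<times> e2)"
    "p1 - centroid p1 p2 p3 p4 = (sqrt 2 / 4) *\<^sub>R (e1 + e2 + e3)"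
    "p2 - centroid p1 p2 p3 p4 = (sqrt 2 / 4) *\<^sub>R (e1 - e2 - e3)"
    "p3 - centroid p1 p2 p3 p4 = (sqrt 2 / 4) *\<^sub>R (- e1 + e2 - e3)"
    "p4 - centroid p1 p2 p3 p4 = (sqrt 2 / 4) *\<^sub>R (- e1 - e2 + e3)"
proof -
  define a b c where "a = p2 - p1" and "b = p3 - p1" and "c = p4 - p1"
  have "norm a = 1" "norm b = 1" "norm c = 1" "norm (a - b) = 1" "norm (a - c) = 1" "norm (b - c) = 1"
    using assms by (simp_all add: tetra_def a_def b_def c_def dist_norm norm_minus_commute)
  then have sq: "a \<bullet> a = 1" "b \<bullet> b = 1" "c \<bullet> c = 1"
    and d: "(a - b) \<bullet> (a - b) = 1" "(a - c) \<bullet> (a - c) = 1" "(b - c) \<bullet> (b - c) = 1"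
    by (simp_all add: norm_eq_1)
  have ip: "a \<bullet> b = 1/2" "a \<bullet> c = 1/2" "b \<bullet> c = 1/2" "b \<bullet> a = 1/2" "c \<bullet> a = 1/2" "c \<bullet> b = 1/2"
    using d sq by (simp_all add: inner_diff_left inner_diff_right inner_commute)
  define r where "r = 1 / sqrt 2"
  have r: "r * r = 1/2" "r * 2 * r = 1" by (simp_all add: r_def)
  \<comment> \<open>\<open>a - b - c\<close> equals \<open>p1 + p2 - p3 - p4\<close>, twice the
    bimedian between the edges \<open>p1 p2\<close> and \<open>p3 p4\<close>; its squared length is
    2, hence the factor \<open>r\<close>.\<close>
  define e1 e2 e3 where "e1 = r *\<^sub>R (a - b - c)" and "e2 = r *\<^sub>R (- a + b - c)" and "e3 = r *\<^sub>R (- a - b + c)"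
  note e_def = e1_def e2_def e3_def
  have "e1 \<bullet> e1 = 1" "e2 \<bullet> e2 = 1" "e3 \<bullet> e3 = 1" "e1 \<bullet> e2 = 0" "e1 \<bullet> e3 = 0" "e2 \<bullet> e3 = 0"
    by (simp_all add: e_def inner_simps sq ip r mult.assoc[symmetric])
  then have "orthonormal e1 e2" "norm e3 = 1" "e1 \<bullet> e3 = 0" "e2 \<bullet> e3 = 0"
    by (simp_all add: orthonormal_def norm_eq_1)
  then have 1: "orthonormal e1 e2" "e3 = e1 \<times> e2 \<or> e3 = - (e1 \<times> e2)"
    using frame_third by auto
  have s: "(sqrt 2 / 4) * r = 1/4" by (simp add: r_def)
  have p: "p2 = p1 + a" "p3 = p1 + b" "p4 = p1 + c" by (simp_all add: a_def b_def c_def)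
  have comp: "(sqrt 2 / 4) *\<^sub>R (e1 + e2 + e3) = (1/4) *\<^sub>R (- a - b - c)"
    "(sqrt 2 / 4) *\<^sub>R (e1 - e2 - e3) = (1/4) *\<^sub>R (3 *\<^sub>R a - b - c)"
    "(sqrt 2 / 4) *\<^sub>R (- e1 + e2 - e3) = (1/4) *\<^sub>R (3 *\<^sub>R b - a - c)"
    "(sqrt 2 / 4) *\<^sub>R (- e1 - e2 + e3) = (1/4) *\<^sub>R (3 *\<^sub>R c - a - b)"
    unfolding s[symmetric] scaleR_scaleR[symmetric]
    by (rule arg_cong[where f = "(*\<^sub>R) (sqrt 2 / 4)"], simp add: e_def vec_eq_iff algebra_simps)+
  show thesis
    by (rule that[OF 1], unfold comp) (simp_all add: centroid_def p vec_eq_iff field_simps)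
qed

text \<open>The vectors from the centroid to the vertices form a tight frame. Projection along
  \<open>u\<close> annihilates the right side, so the heights \<open>u \<bullet> (p - c)\<close>
  become the coefficients of an affine dependence between the projected vertices.\<close>

lemma tetra_tight_frame:
  assumes "tetra p1 p2 p3 p4"
  defines "c \<equiv> centroid p1 p2 p3 p4"
  shows "(u \<bullet> (p1 - c)) *\<^sub>R (p1 - c) + (u \<bullet> (p2 - c)) *\<^sub>R (p2 - c)
    + (u \<bullet> (p3 - c)) *\<^sub>R (p3 - c) + (u \<bullet> (p4 - c)) *\<^sub>R (p4 - c) = (1/2) *\<^sub>R u"
proof -
  obtain e1 e2 e3 where o: "orthonormal e1 e2" and e3: "e3 = e1 \<times> e2 \<or> e3 = - (e1 \<times> e2)"
    and p: "p1 - c = (sqrt 2 / 4) *\<^sub>R (e1 + e2 + e3)"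
    "p2 - c = (sqrt 2 / 4) *\<^sub>R (e1 - e2 - e3)"
    "p3 - c = (sqrt 2 / 4) *\<^sub>R (- e1 + e2 - e3)"
    "p4 - c = (sqrt 2 / 4) *\<^sub>R (- e1 - e2 + e3)"
    using tetra_frame[OF assms(1)] unfolding c_def by metis
  have u: "u = (e1 \<bullet> u) *\<^sub>R e1 + (e2 \<bullet> u) *\<^sub>R e2 + (e3 \<bullet> u) *\<^sub>R e3"
    using frame_expansion[OF o, of u] e3 by auto
  define x y z where "x = e1 \<bullet> u" and "y = e2 \<bullet> u" and "z = e3 \<bullet> u"
  have ip: "u \<bullet> e1 = x" "u \<bullet> e2 = y" "u \<bullet> e3 = z" by (simp_all add: x_def y_def z_def inner_commute)
  have s: "(sqrt 2 / 4 * t) *\<^sub>R (sqrt 2 / 4) *\<^sub>R w = (1/8) *\<^sub>R t *\<^sub>R w" for t and w :: "real^3"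
    by simp
  have "u = x *\<^sub>R e1 + y *\<^sub>R e2 + z *\<^sub>R e3" using u unfolding x_def y_def z_def .
  then show ?thesis
    unfolding p inner_scaleR_right s inner_add_right inner_diff_right inner_minus_right ip
    by (simp add: vec_eq_iff field_simps)
qed

text \<open>The face opposite \<open>p4\<close> is orthogonal to \<open>p4 - c\<close>. Hence the
  area of its projection is proportional to the height of \<open>p4\<close> in direction
  \<open>u\<close>.\<close>

lemma tetra_face:
  assumes "tetra p1 p2 p3 p4"
  shows "\<bar>u \<bullet> ((p2 - p1) \<times> (p3 - p1))\<bar> = sqrt 2 * \<bar>u \<bullet> (p4 - centroid p1 p2 p3 p4)\<bar>"
proof -
  define c where "c = centroid p1 p2 p3 p4"
  obtain e1 e2 e3 where o: "orthonormal e1 e2" and e3: "e3 = e1 \<times> e2 \<or> e3 = - (e1 \<times> e2)"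
    and p: "p1 - c = (sqrt 2 / 4) *\<^sub>R (e1 + e2 + e3)"
    "p2 - c = (sqrt 2 / 4) *\<^sub>R (e1 - e2 - e3)"
    "p3 - c = (sqrt 2 / 4) *\<^sub>R (- e1 + e2 - e3)"
    "p4 - c = (sqrt 2 / 4) *\<^sub>R (- e1 - e2 + e3)"
    using tetra_frame[OF assms(1)] unfolding c_def by metis
  have ip: "e1 \<bullet> e1 = 1" "e2 \<bullet> e2 = 1" "e1 \<bullet> e2 = 0" "e2 \<bullet> e1 = 0"
    using o by (auto simp: orthonormal_def norm_eq_1 inner_commute)
  \<comment> \<open>\<open>\<sigma>\<close> is the orientation of the frame, which depends on the
    labelling of the vertices and disappears in the absolute value.\<close>
  obtain \<sigma> :: real where \<sigma>: "\<sigma> = 1 \<or> \<sigma> = -1" "e3 = \<sigma> *\<^sub>R (e1 \<times> e2)"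
    using e3 by (metis scaleR_minus1_left scaleR_one)
  then have \<sigma>2: "\<sigma> * \<sigma> = 1" by auto
  have cr: "e1 \<times> e2 = \<sigma> *\<^sub>R e3" "e2 \<times> e3 = \<sigma> *\<^sub>R e1" "e3 \<times> e1 = \<sigma> *\<^sub>R e2"
    using cross_skew[of "e1 \<times> e2" e1] by (simp_all add: \<sigma>(2) \<sigma>2 cross_mult_left cross_mult_right Lagrange ip)
  have "p2 - p1 = (p2 - c) - (p1 - c)" "p3 - p1 = (p3 - c) - (p1 - c)" by simp_all
  then have d: "p2 - p1 = (- sqrt 2 / 2) *\<^sub>R (e2 + e3)" "p3 - p1 = (- sqrt 2 / 2) *\<^sub>R (e1 + e3)"
    unfolding p by (simp_all add: vec_eq_iff field_simps)
  have "(e2 + e3) \<times> (e1 + e3) = \<sigma> *\<^sub>R (e1 + e2 - e3)"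
    using cr cross_skew[of e2 e1]
    by (simp add: cross_add_left cross_add_right scaleR_add_right scaleR_diff_right)
  then have "(p2 - p1) \<times> (p3 - p1) = (1/2) *\<^sub>R \<sigma> *\<^sub>R (e1 + e2 - e3)"
    unfolding d cross_mult_left cross_mult_right by simp
  also have "\<dots> = (- \<sigma> * sqrt 2) *\<^sub>R (p4 - c)"
    unfolding p by (simp add: vec_eq_iff field_simps)
  finally show ?thesis using \<sigma>(1) by (auto simp: c_def abs_mult)
qed

text \<open>The heights play both roles in \<open>measure_hull_4\<close>: they are the coefficients
  of the dependence, by \<open>tetra_tight_frame\<close>, and up to the factor
  \<open>1 / sqrt 2\<close> their absolute values are the areas of the projected opposite faces, by
  \<open>tetra_face\<close>.\<close>

lemma tetra_brightness_ordered:
  assumes T: "tetra p1 p2 p3 p4" and u: "norm u = 1"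
  defines "h \<equiv> \<lambda>p. u \<bullet> (p - centroid p1 p2 p3 p4)"
  assumes ord: "h p1 \<ge> h p2" "h p2 \<ge> h p3" "h p3 \<ge> h p4"
  shows "brightness (convex hull {p1, p2, p3, p4}) u
    = (1 / sqrt 2) * (\<bar>h p1\<bar> + \<bar>h p2\<bar> + \<bar>h p3\<bar> + \<bar>h p4\<bar>) / 2"
proof -
  define c where "c = centroid p1 p2 p3 p4"
  have h: "h p = u \<bullet> (p - c)" for p by (simp add: h_def c_def)
  obtain \<pi> :: "real^3 \<Rightarrow> real^2" where \<pi>: "linear \<pi>" "\<pi> u = 0"
    and area: "\<And>x y. \<bar>area_form (\<pi> x) (\<pi> y)\<bar> = \<bar>u \<bullet> (x \<times> y)\<bar>"
    and hull: "\<And>V. finite V \<Longrightarrow> brightness (convex hull V) u = measure lebesgue (convex hull (\<pi> ` V))"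
    using brightness_hull[OF u] by blast
  have "(p1 - c) + (p2 - c) + (p3 - c) + (p4 - c) = 0"
    by (simp add: c_def centroid_def vec_eq_iff field_simps)
  then have "u \<bullet> ((p1 - c) + (p2 - c) + (p3 - c) + (p4 - c)) = 0" by simp
  then have sum: "h p1 + h p2 + h p3 + h p4 = 0"
    unfolding h by (simp only: inner_add_right)
  note tight = tetra_tight_frame[OF T, of u, folded c_def, folded h]
  have nz: "h p1 \<noteq> 0"
  proof
    assume "h p1 = 0"
    then have "h p1 = 0" "h p2 = 0" "h p3 = 0" "h p4 = 0" using sum ord by linarith+
    then have "u = 0" using tight by simp
    then show False using u by simp
  qed
  have "\<pi> (h p1 *\<^sub>R (p1 - c) + h p2 *\<^sub>R (p2 - c) + h p3 *\<^sub>R (p3 - c) + h p4 *\<^sub>R (p4 - c)) = 0"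
    unfolding tight by (simp add: linear_scale[OF \<pi>(1)] \<pi>(2))
  then have "h p1 *\<^sub>R \<pi> p1 + h p2 *\<^sub>R \<pi> p2 + h p3 *\<^sub>R \<pi> p3 + h p4 *\<^sub>R \<pi> p4
      - (h p1 + h p2 + h p3 + h p4) *\<^sub>R \<pi> c = 0"
    by (simp add: linear_add[OF \<pi>(1)] linear_diff[OF \<pi>(1)] linear_scale[OF \<pi>(1)] algebra_simps)
  then have dep: "h p1 *\<^sub>R \<pi> p1 + h p2 *\<^sub>R \<pi> p2 + h p3 *\<^sub>R \<pi> p3 + h p4 *\<^sub>R \<pi> p4 = 0"
    by (simp add: sum)
  have face: "measure lebesgue (convex hull {\<pi> a, \<pi> b, \<pi> d}) = (1 / sqrt 2) * \<bar>h e\<bar>"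
    if "tetra a b d e" "centroid a b d e = c" for a b d e
  proof -
    have "measure lebesgue (convex hull {\<pi> a, \<pi> b, \<pi> d}) = \<bar>u \<bullet> ((b - a) \<times> (d - a))\<bar> / 2"
      unfolding measure_triangle linear_diff[OF \<pi>(1), symmetric] area ..
    also have "\<dots> = sqrt 2 * \<bar>h e\<bar> / 2" using tetra_face[OF that(1), of u] by (simp add: that(2) h)
    also have "\<dots> = (1 / sqrt 2) * \<bar>h e\<bar>" by (simp add: field_simps)
    finally show ?thesis .
  qed
  have perm: "tetra p2 p3 p4 p1" "tetra p1 p2 p4 p3" "centroid p2 p3 p4 p1 = c" "centroid p1 p2 p4 p3 = c"
    using T by (auto simp: tetra_def c_def centroid_def dist_commute add_ac)
  have "brightness (convex hull {p1, p2, p3, p4}) u = measure lebesgue (convex hull {\<pi> p1, \<pi> p2, \<pi> p3, \<pi> p4})"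
    by (subst hull) auto
  also have "\<dots> = (1 / sqrt 2) * (\<bar>h p1\<bar> + \<bar>h p2\<bar> + \<bar>h p3\<bar> + \<bar>h p4\<bar>) / 2"
    by (rule measure_hull_4[OF sum dep ord nz])
       (use face[OF perm(1,3)] face[OF perm(2,4)] face[OF T] in \<open>simp_all add: c_def\<close>)
  finally show ?thesis .
qed

lemma ordered_enumeration_4:
  fixes h :: "'a \<Rightarrow> real"
  assumes "card V = 4"
  obtains p1 p2 p3 p4 where "V = {p1, p2, p3, p4}" "distinct [p1, p2, p3, p4]"
    "h p1 \<ge> h p2" "h p2 \<ge> h p3" "h p3 \<ge> h p4"
proof -
  have "finite V" using assms by (metis card.infinite zero_neq_numeral)
  then obtain xs where xs: "set xs = V" "distinct xs" using finite_distinct_list by blast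
  define ys where "ys = sort_key h xs"
  have ys: "set ys = V" "distinct ys" "sorted (map h ys)" by (simp_all add: ys_def xs)
  then have "length ys = Suc (Suc (Suc (Suc 0)))" using assms distinct_card[of ys] by simp
  then obtain a b c d where "ys = [a, b, c, d]" by (auto simp: length_Suc_conv)
  then show thesis using that[of d c b a] ys by auto
qed

text \<open>The order of the vertices by height depends on \<open>u\<close>, but the sum of the
  absolute heights is symmetric in the vertices. One labelling, and so one frame, therefore serves
  all directions.\<close>

lemma brightness_unit_regular_tetrahedron:
  assumes "unit_regular_tetrahedron T"
  obtains n p where "orthonormal n p"
    "\<And>u. norm u = 1 \<Longrightarrow> brightness T u
      = max (max \<bar>n \<bullet> u\<bar> (max \<bar>p \<bullet> u\<bar> \<bar>(n \<times> p) \<bullet> u\<bar>) / 2)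
          ((\<bar>n \<bullet> u\<bar> + \<bar>p \<bullet> u\<bar> + \<bar>(n \<times> p) \<bullet> u\<bar>) / 4)"
proof -
  obtain V where V: "card V = 4" "\<forall>x\<in>V. \<forall>y\<in>V. x \<noteq> y \<longrightarrow> dist x y = 1" "T = convex hull V"
    using assms unfolding unit_regular_tetrahedron_def by blast
  obtain q1 q2 q3 q4 where q: "V = {q1, q2, q3, q4}" "distinct [q1, q2, q3, q4]"
    using ordered_enumeration_4[OF V(1), of "\<lambda>_. 0"] by metis
  define m where "m = (\<Sum>x\<in>V. x) /\<^sub>R 4"
  have tetra: "tetra p1 p2 p3 p4" and cent: "centroid p1 p2 p3 p4 = m"
    if "V = {p1, p2, p3, p4}" "distinct [p1, p2, p3, p4]" for p1 p2 p3 p4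
    using that V(2) by (auto simp: tetra_def m_def centroid_def add_ac)
  have br: "brightness T u = (\<Sum>x\<in>V. \<bar>u \<bullet> (x - m)\<bar>) / (2 * sqrt 2)" if "norm u = 1" for u
  proof -
    obtain p1 p2 p3 p4 where p: "V = {p1, p2, p3, p4}" "distinct [p1, p2, p3, p4]"
      and ord: "u \<bullet> (p1 - m) \<ge> u \<bullet> (p2 - m)" "u \<bullet> (p2 - m) \<ge> u \<bullet> (p3 - m)" "u \<bullet> (p3 - m) \<ge> u \<bullet> (p4 - m)"
      using ordered_enumeration_4[OF V(1), of "\<lambda>x. u \<bullet> (x - m)"] by blast
    have "brightness T u = (1 / sqrt 2) * (\<bar>u \<bullet> (p1 - m)\<bar> + \<bar>u \<bullet> (p2 - m)\<bar> + \<bar>u \<bullet> (p3 - m)\<bar> + \<bar>u \<bullet> (p4 - m)\<bar>) / 2"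
      using tetra_brightness_ordered[OF tetra[OF p] that, unfolded cent[OF p], OF ord] V(3) p(1) by simp
    also have "\<dots> = (\<Sum>x\<in>V. \<bar>u \<bullet> (x - m)\<bar>) / (2 * sqrt 2)"
      using p by (simp add: add_ac)
    finally show ?thesis .
  qed
  obtain e1 e2 e3 where o: "orthonormal e1 e2" and e3: "e3 = e1 \<times> e2 \<or> e3 = - (e1 \<times> e2)"
    and v: "q1 - m = (sqrt 2 / 4) *\<^sub>R (e1 + e2 + e3)"
    "q2 - m = (sqrt 2 / 4) *\<^sub>R (e1 - e2 - e3)"
    "q3 - m = (sqrt 2 / 4) *\<^sub>R (- e1 + e2 - e3)"
    "q4 - m = (sqrt 2 / 4) *\<^sub>R (- e1 - e2 + e3)"
    using tetra_frame[OF tetra[OF q]] unfolding cent[OF q] by metis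
  have cancel: "(sqrt 2 / 4) * w / (2 * sqrt 2) = w / 8" for w :: real
    by (simp add: field_simps)
  show thesis
  proof (rule that[OF o])
    fix u :: "real^3" assume u: "norm u = 1"
    define x y z where "x = e1 \<bullet> u" and "y = e2 \<bullet> u" and "z = e3 \<bullet> u"
    have ip: "u \<bullet> e1 = x" "u \<bullet> e2 = y" "u \<bullet> e3 = z" by (simp_all add: x_def y_def z_def inner_commute)
    have "(\<Sum>x\<in>V. \<bar>u \<bullet> (x - m)\<bar>)
      = \<bar>u \<bullet> (q1 - m)\<bar> + \<bar>u \<bullet> (q2 - m)\<bar> + \<bar>u \<bullet> (q3 - m)\<bar> + \<bar>u \<bullet> (q4 - m)\<bar>"
      using q by (simp add: add_ac)
    also have "\<dots> = (sqrt 2 / 4) * (\<bar>x + y + z\<bar> + \<bar>x - y - z\<bar> + \<bar>- x + y - z\<bar> + \<bar>- x - y + z\<bar>)"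
      unfolding v inner_scaleR_right inner_add_right inner_diff_right inner_minus_right ip abs_mult
      by (simp only: distrib_left) simp
    finally have sumV: "(\<Sum>x\<in>V. \<bar>u \<bullet> (x - m)\<bar>) = (sqrt 2 / 4) * (\<bar>x + y + z\<bar> + \<bar>x - y - z\<bar> + \<bar>- x + y - z\<bar> + \<bar>- x - y + z\<bar>)" .
    have "brightness T u = ((sqrt 2 / 4) * (\<bar>x + y + z\<bar> + \<bar>x - y - z\<bar> + \<bar>- x + y - z\<bar> + \<bar>- x - y + z\<bar>)) / (2 * sqrt 2)"
      unfolding br[OF u] sumV ..
    also have "\<dots> = (\<bar>x + y + z\<bar> + \<bar>x - y - z\<bar> + \<bar>- x + y - z\<bar> + \<bar>- x - y + z\<bar>) / 8"
      by (rule cancel)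
    also have "\<dots> = max (max \<bar>x\<bar> (max \<bar>y\<bar> \<bar>z\<bar>) / 2) ((\<bar>x\<bar> + \<bar>y\<bar> + \<bar>z\<bar>) / 4)"
      unfolding bt_abs_identity by simp
    finally have b: "brightness T u = max (max \<bar>x\<bar> (max \<bar>y\<bar> \<bar>z\<bar>) / 2) ((\<bar>x\<bar> + \<bar>y\<bar> + \<bar>z\<bar>) / 4)" .
    have z: "\<bar>z\<bar> = \<bar>(e1 \<times> e2) \<bullet> u\<bar>" using e3 by (auto simp: z_def)
    show "brightness T u = max (max \<bar>e1 \<bullet> u\<bar> (max \<bar>e2 \<bullet> u\<bar> \<bar>(e1 \<times> e2) \<bullet> u\<bar>) / 2)
          ((\<bar>e1 \<bullet> u\<bar> + \<bar>e2 \<bullet> u\<bar> + \<bar>(e1 \<times> e2) \<bullet> u\<bar>) / 4)"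
      using b unfolding z x_def[symmetric] y_def[symmetric] .
  qed
qed

section \<open>Cap and sector probabilities on the scale of the brightness\<close>

context rotation_invariant begin

text \<open>Makes the boundaries of the regions negligible, where two of the linear expressions for
  the brightness agree.\<close>

lemma AE_inner_neq:
  assumes "v \<noteq> 0"
  shows "AE u in N. v \<bullet> u \<noteq> c"
proof -
  define n where "n = v /\<^sub>R norm v"
  have n: "norm n = 1" using assms by (simp add: n_def)
  have "AE x in unif. x \<noteq> c / norm v"
    unfolding unif_def using AE_lborel_singleton[of "c / norm v"] by (subst AE_density) auto
  then have "AE u in N. n \<bullet> u \<noteq> c / norm v"
    unfolding distr_inner[OF n, symmetric] by (subst (asm) AE_distr_iff) auto
  then show ?thesis
    by eventually_elim (use assms in \<open>simp add: n_def field_simps\<close>)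
qed

lemma integrable_of_bool:
  "Measurable.pred N P \<Longrightarrow> integrable N (\<lambda>u. if P u then 1 else 0 :: real)"
  by (rule integrable_const_bound[where B = 1]) auto

text \<open>Here and in \<open>integral_sector\<close>, \<open>r\<close> is the ratio of the
  brightness to the coordinate along the axis of the region: \<open>1 / 2\<close> for a square and
  \<open>sqrt 3 / 4\<close> for a triangle.\<close>

lemma integral_inner_mem:
  assumes n: "norm n = 1" and r: "r > 0" and [measurable]: "S \<in> sets borel" and S: "S \<subseteq> {0<..<r}"
  shows "(\<integral>u. (if r * (n \<bullet> u) \<in> S then 1 else 0 :: real) \<partial>N) = (\<integral>t. indicator S t \<partial>lborel) / (2 * r)"
proof -
  have "(\<integral>u. (if r * (n \<bullet> u) \<in> S then 1 else 0 :: real) \<partial>N)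
      = (\<integral>z. (if r * z \<in> S then 1 else 0 :: real) \<partial>distr N borel (\<lambda>u. n \<bullet> u))"
    by (subst integral_distr) auto
  also have "\<dots> = (LINT z:{-1..1}|lborel. (if r * z \<in> S then 1 else 0)) / 2"
    unfolding distr_inner[OF n] by (rule integral_unif) measurable
  also have "(LINT z:{-1..1}|lborel. (if r * z \<in> S then 1 else 0 :: real)) = (\<integral>z. indicator S (0 + r * z) \<partial>lborel)"
    unfolding set_lebesgue_integral_def
  proof (rule Bochner_Integration.integral_cong[OF refl])
    fix z
    have "z \<in> {-1..1}" if "r * z \<in> S"
      using that S r by (auto simp: zero_less_mult_iff dest!: subsetD)
    then show "indicator {-1..1} z *\<^sub>R (if r * z \<in> S then 1 else 0) = (indicator S (0 + r * z) :: real)"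
      by (auto simp: indicator_def)
  qed
  also have "\<dots> = (\<integral>t. indicator S t \<partial>lborel) / r"
    using r by (subst (2) lborel_integral_real_affine[where c = r and t = 0]) simp_all
  finally show ?thesis by (simp add: field_simps)
qed

lemma integral_sector:
  assumes np: "orthonormal n p" and k: "0 \<le> k" and r: "r > 0"
    and S [measurable]: "S \<in> sets borel" and S_sub: "S \<subseteq> {0<..<r}"
  shows "(\<integral>u. (if r * (n \<bullet> u) \<in> S \<and> k * (n \<bullet> u) < p \<bullet> u then 1 else 0 :: real) \<partial>N)
    = (\<integral>t. indicator S t * half_arc (k * (t / r) / sqrt (1 - (t / r)\<^sup>2)) \<partial>lborel) / (2 * pi * r)"
proof -
  define S0 where "S0 = {z. r * z \<in> S}"
  have [measurable]: "S0 \<in> sets borel" unfolding S0_def by measurable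
  have "S0 \<subseteq> {0<..<1}"
    using S_sub r by (auto simp: S0_def zero_less_mult_iff dest!: subsetD)
  define A where "A = {u. n \<bullet> u \<in> S0 \<and> k * (n \<bullet> u) < p \<bullet> u}"
  have "{u \<in> space N. n \<bullet> u \<in> S0 \<and> k * (n \<bullet> u) < p \<bullet> u} \<in> sets N" by measurable
  then have A: "A \<in> sets N" by (simp add: A_def sets_eq_imp_space_eq[OF sets_N])
  define g where "g z = indicator S0 z * half_arc (k * z / sqrt (1 - z\<^sup>2))" for z
  have "ennreal (2 * pi * measure N A) = (\<integral>\<^sup>+ z. ennreal (g z) \<partial>lborel)"
    using emeasure_sector[OF np k _ \<open>S0 \<subseteq> _\<close>]
    by (simp add: A_def[symmetric] g_def emeasure_eq_measure ennreal_mult)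
  then have "2 * pi * measure N A = enn2real (\<integral>\<^sup>+ z. ennreal (g z) \<partial>lborel)"
    by (metis enn2real_ennreal measure_nonneg mult_nonneg_nonneg pi_ge_zero zero_le_numeral)
  also have "\<dots> = (\<integral>z. g z \<partial>lborel)"
    by (rule integral_eq_nn_integral[symmetric]) (simp_all add: g_def half_arc_bounds)
  also have "\<dots> = (\<integral>t. indicator S t * half_arc (k * (t / r) / sqrt (1 - (t / r)\<^sup>2)) \<partial>lborel) / r"
    unfolding g_def using r by (subst (2) lborel_integral_real_affine[where c = r and t = 0])
      (simp_all add: S0_def indicator_def)
  finally have "2 * pi * measure N A = (\<integral>t. indicator S t * half_arc (k * (t / r) / sqrt (1 - (t / r)\<^sup>2)) \<partial>lborel) / r" .
  moreover have "measure N A = (2 * pi * measure N A) / (2 * pi)" by simp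
  ultimately have "measure N A = (\<integral>t. indicator S t * half_arc (k * (t / r) / sqrt (1 - (t / r)\<^sup>2)) \<partial>lborel) / (2 * pi * r)"
    by (simp only: divide_divide_eq_left mult.commute)
  moreover have "(\<integral>u. (if r * (n \<bullet> u) \<in> S \<and> k * (n \<bullet> u) < p \<bullet> u then 1 else 0 :: real) \<partial>N) = (\<integral>u. indicator A u \<partial>N)"
    by (rule Bochner_Integration.integral_cong) (auto simp: A_def S0_def indicator_def)
  ultimately show ?thesis using A by simp
qed

end

subsection \<open>Regions of linearity of the brightness\<close>

text \<open>On \<open>axis_region\<close> the brightness is \<open>x / 2\<close>, on \<open>diag_region\<close> it is \<open>(x + y + z) / 4\<close>. Each region
  is, almost surely, a spherical cap minus pairwise disjoint sectors of that cap.\<close>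

definition axis_region :: "real set \<Rightarrow> real \<Rightarrow> real \<Rightarrow> real \<Rightarrow> real" where
  "axis_region S x y z = (if x > \<bar>y\<bar> + \<bar>z\<bar> \<and> x / 2 \<in> S then 1 else 0)"

definition diag_region :: "real set \<Rightarrow> real \<Rightarrow> real \<Rightarrow> real \<Rightarrow> real" where
  "diag_region S x y z = (if 2 * x < x + y + z \<and> 2 * y < x + y + z \<and> 2 * z < x + y + z
     \<and> (x + y + z) / 4 \<in> S then 1 else 0)"

lemma tau0_sq: "\<tau>\<^sub>0\<^sup>2 = 1 / 8" "0 < \<tau>\<^sub>0"
  by (simp_all add: \<tau>\<^sub>0_def power_divide power_mult_distrib)

text \<open>On the cap \<open>x^2 > 1 / 2\<close>, so \<open>\<bar>y\<bar> < x\<close> and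
  \<open>\<bar>z\<bar> < x\<close>. Two of the four inequalities at once would add up to
  \<open>x < y\<close>, \<open>x < z\<close>, their negatives, or \<open>x < 0\<close>, so the
  sectors are disjoint. Conversely, \<open>x > \<bar>y\<bar> + \<bar>z\<bar>\<close> implies
  \<open>x^2 > y^2 + z^2\<close>, so the region lies in the cap. The excluded value
  \<open>x = 1\<close> is the pole, which the open interval omits.\<close>

lemma axis_region_split:
  fixes x y z :: real and S :: "real set"
  assumes sq: "x\<^sup>2 + y\<^sup>2 + z\<^sup>2 = 1"
    and ne: "x \<noteq> y + z" "x \<noteq> y - z" "x \<noteq> - y + z" "x \<noteq> - y - z" "x \<noteq> 1"
  defines "Q \<equiv> (1/2) * x \<in> S \<inter> {\<tau>\<^sub>0<..<1/2}"
  shows "axis_region S x y z = (if Q then 1 else 0)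
     - (if Q \<and> x < y + z then 1 else 0) - (if Q \<and> x < y - z then 1 else 0)
     - (if Q \<and> x < - y + z then 1 else 0) - (if Q \<and> x < - y - z then 1 else 0)"
proof (cases Q)
  case True
  then have x: "\<tau>\<^sub>0 < x / 2" "x / 2 \<in> S" by (auto simp: Q_def)
  then have "\<tau>\<^sub>0\<^sup>2 < (x / 2)\<^sup>2" "0 < x" using tau0_sq(2) by (auto intro!: power_strict_mono)
  then have "1 / 2 < x\<^sup>2" by (simp add: tau0_sq power_divide)
  then have "y\<^sup>2 < x\<^sup>2" "z\<^sup>2 < x\<^sup>2" using sq zero_le_power2[of y] zero_le_power2[of z] by linarith+
  then have "\<bar>y\<bar> < x" "\<bar>z\<bar> < x" using \<open>0 < x\<close> by (auto intro: power2_less_imp_less)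
  then show ?thesis using True ne x(2) by (auto simp: axis_region_def)
next
  case False
  have "\<not> (x > \<bar>y\<bar> + \<bar>z\<bar> \<and> x / 2 \<in> S)"
  proof
    assume a: "x > \<bar>y\<bar> + \<bar>z\<bar> \<and> x / 2 \<in> S"
    then have "(\<bar>y\<bar> + \<bar>z\<bar>)\<^sup>2 < x\<^sup>2" by (intro power_strict_mono) auto
    then have "y\<^sup>2 + z\<^sup>2 < x\<^sup>2" by (simp add: power2_sum) (smt (verit) mult_nonneg_nonneg abs_ge_zero)
    then have "\<tau>\<^sub>0\<^sup>2 < (x / 2)\<^sup>2" using sq by (simp add: tau0_sq power_divide)
    moreover have "0 \<le> x / 2" using a by linarith
    ultimately have "\<tau>\<^sub>0 < x / 2" by (rule power2_less_imp_less)
    moreover have "x\<^sup>2 \<le> 1" using sq zero_le_power2[of y] zero_le_power2[of z] by linarith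
    then have "x \<le> 1" using power2_le_imp_le[of x 1] by simp
    ultimately show False using False a ne by (auto simp: Q_def)
  qed
  then show ?thesis using False by (simp add: axis_region_def)
qed

text \<open>Let \<open>s = x + y + z\<close>. On the cap \<open>s^2 > 2\<close>. Two sectors meeting
  would give \<open>s < 2 * a\<close> and \<open>s < 2 * b\<close> for two of the coordinates, hence
  \<open>s^2 < 2 * (a^2 + b^2) \<le> 2\<close>. The excluded value \<open>sqrt 3\<close> is the
  pole.\<close>

lemma diag_region_split:
  fixes x y z :: real and S :: "real set"
  assumes sq: "x\<^sup>2 + y\<^sup>2 + z\<^sup>2 = 1"
    and ne: "x \<noteq> y + z" "y \<noteq> x + z" "z \<noteq> x + y" "x + y + z \<noteq> sqrt 3"
  defines "Q \<equiv> (x + y + z) / 4 \<in> S \<inter> {\<tau>\<^sub>0<..<sqrt 3 / 4}"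
  shows "diag_region S x y z = (if Q then 1 else 0) - (if Q \<and> y + z < x then 1 else 0)
     - (if Q \<and> x + z < y then 1 else 0) - (if Q \<and> x + y < z then 1 else 0)"
proof (cases Q)
  case True
  define s where "s = x + y + z"
  have s: "\<tau>\<^sub>0 < s / 4" "s / 4 \<in> S" using True by (auto simp: Q_def s_def)
  then have "\<tau>\<^sub>0\<^sup>2 < (s / 4)\<^sup>2" "0 < s" using tau0_sq(2) by (auto intro!: power_strict_mono)
  then have s2: "2 < s\<^sup>2" by (simp add: tau0_sq power_divide)
  have excl: False if "s < 2 * a" "s < 2 * b" "a\<^sup>2 + b\<^sup>2 \<le> 1" for a b
  proof -
    have "s\<^sup>2 < (2 * a)\<^sup>2" using that(1) by (rule power_strict_mono) (use \<open>0 < s\<close> in simp_all)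
    moreover have "s\<^sup>2 < (2 * b)\<^sup>2" using that(2) by (rule power_strict_mono) (use \<open>0 < s\<close> in simp_all)
    ultimately show False using s2 that(3) by (simp add: power_mult_distrib)
  qed
  have "x\<^sup>2 + y\<^sup>2 \<le> 1" "x\<^sup>2 + z\<^sup>2 \<le> 1" "y\<^sup>2 + z\<^sup>2 \<le> 1"
    using sq zero_le_power2[of x] zero_le_power2[of y] zero_le_power2[of z] by linarith+
  then have "\<not> (s < 2 * x \<and> s < 2 * y)" "\<not> (s < 2 * x \<and> s < 2 * z)" "\<not> (s < 2 * y \<and> s < 2 * z)"
    using excl by blast+
  then show ?thesis using True ne s(2) unfolding diag_region_def s_def by auto
next
  case False
  have "\<not> (2 * x < x + y + z \<and> 2 * y < x + y + z \<and> 2 * z < x + y + z \<and> (x + y + z) / 4 \<in> S)"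
  proof
    assume a: "2 * x < x + y + z \<and> 2 * y < x + y + z \<and> 2 * z < x + y + z \<and> (x + y + z) / 4 \<in> S"
    then have pos: "0 < x" "0 < y" "0 < z" by linarith+
    \<comment> \<open>On the unit sphere this sum equals \<open>(x + y + z)^2 - 2\<close>.\<close>
    then have "0 < x * (y + z - x) + y * (x + z - y) + z * (x + y - z)"
      using a by (intro add_pos_pos mult_pos_pos) auto
    then have "2 < (x + y + z)\<^sup>2" using sq by (simp add: power2_eq_square algebra_simps)
    then have "\<tau>\<^sub>0\<^sup>2 < ((x + y + z) / 4)\<^sup>2" by (simp add: tau0_sq power_divide)
    then have "\<tau>\<^sub>0 < (x + y + z) / 4" by (rule power2_less_imp_less) (use pos in simp)
    \<comment> \<open>The inequality of Cauchy and Schwarz with its defect written as a sum of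
      squares.\<close>
    moreover have "(x + y + z)\<^sup>2 + (x - y)\<^sup>2 + (x - z)\<^sup>2 + (y - z)\<^sup>2 = 3 * (x\<^sup>2 + y\<^sup>2 + z\<^sup>2)"
      by (simp add: power2_eq_square algebra_simps)
    then have "(x + y + z)\<^sup>2 \<le> 3"
      unfolding sq using zero_le_power2[of "x - y"] zero_le_power2[of "x - z"] zero_le_power2[of "y - z"] by linarith
    then have "(x + y + z)\<^sup>2 \<le> (sqrt 3)\<^sup>2" by simp
    then have "x + y + z \<le> sqrt 3" by (rule power2_le_imp_le) simp
    ultimately show False using False a ne by (auto simp: Q_def)
  qed
  then show ?thesis using False by (simp add: diag_region_def)
qed

definition bt :: "real \<Rightarrow> real \<Rightarrow> real \<Rightarrow> real" where
  "bt x y z = max (max \<bar>x\<bar> (max \<bar>y\<bar> \<bar>z\<bar>) / 2) ((\<bar>x\<bar> + \<bar>y\<bar> + \<bar>z\<bar>) / 4)"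

lemma sum_signs:
  fixes h :: "real \<Rightarrow> real"
  assumes "\<And>t. t \<le> 0 \<Longrightarrow> h t = 0"
  shows "(\<Sum>s\<in>{1, -1}. h (s * t)) = h \<bar>t\<bar>"
  using assms[of t] assms[of "-t"] assms[of 0] by (cases "t \<ge> 0") auto

text \<open>With signs in place of absolute values, every summand is a region function in a
  reflected or permuted frame, the form that \<open>integral_axis_region\<close> and
  \<open>integral_diag_region\<close> evaluate.\<close>

lemma bt_decomposition:
  fixes x y z :: real
  assumes ne: "\<bar>x\<bar> \<noteq> \<bar>y\<bar> + \<bar>z\<bar>" "\<bar>y\<bar> \<noteq> \<bar>x\<bar> + \<bar>z\<bar>" "\<bar>z\<bar> \<noteq> \<bar>x\<bar> + \<bar>y\<bar>"
  shows "(if bt x y z \<in> S then 1 else 0) = (\<Sum>s\<in>{1, -1}. axis_region S (s * x) y z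
     + axis_region S (s * y) x z + axis_region S (s * z) x y)
     + (\<Sum>s\<in>{1, -1}. \<Sum>s'\<in>{1, -1}. \<Sum>s''\<in>{1, -1}. diag_region S (s * x) (s' * y) (s'' * z))"
proof -
  have a: "(\<Sum>s\<in>{1, -1}. axis_region S (s * p) q r) = axis_region S \<bar>p\<bar> q r" for p q r
    by (rule sum_signs) (auto simp: axis_region_def)
  have d: "(\<Sum>s\<in>{1, -1}. diag_region S p q (s * r)) = diag_region S p q \<bar>r\<bar>"
    "(\<Sum>s\<in>{1, -1}. diag_region S p (s * r) q) = diag_region S p \<bar>r\<bar> q"
    "(\<Sum>s\<in>{1, -1}. diag_region S (s * r) p q) = diag_region S \<bar>r\<bar> p q" for p q r
    using sum_signs[of "\<lambda>t. diag_region S p q t" r] sum_signs[of "\<lambda>t. diag_region S p t q" r]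
      sum_signs[of "\<lambda>t. diag_region S t p q" r] by (simp_all add: diag_region_def)
  have region: "(if max (max X (max Y Z) / 2) ((X + Y + Z) / 4) \<in> S then 1 else 0) =
      (if X > Y + Z \<and> X / 2 \<in> S then 1 else 0) + (if Y > X + Z \<and> Y / 2 \<in> S then 1 else 0)
      + (if Z > X + Y \<and> Z / 2 \<in> S then 1 else 0) + (if 2 * X < X + Y + Z \<and> 2 * Y < X + Y + Z
      \<and> 2 * Z < X + Y + Z \<and> (X + Y + Z) / 4 \<in> S then 1 else 0 :: real)"
    if nn: "0 \<le> X" "0 \<le> Y" "0 \<le> Z" and ne: "X \<noteq> Y + Z" "Y \<noteq> X + Z" "Z \<noteq> X + Y" for X Y Z
  proof -
    consider "X > Y + Z" | "Y > X + Z" | "Z > X + Y" | "X < Y + Z" "Y < X + Z" "Z < X + Y"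
      using ne by linarith
    then show ?thesis
    proof cases
      case 1
      then have "max X (max Y Z) = X" using nn by simp
      moreover have "(X + Y + Z) / 4 \<le> X / 2" using 1 by simp
      ultimately show ?thesis using 1 nn by (simp add: max_absorb1)
    next
      case 2
      then have "max X (max Y Z) = Y" using nn by simp
      moreover have "(X + Y + Z) / 4 \<le> Y / 2" using 2 by simp
      ultimately show ?thesis using 2 nn by (simp add: max_absorb1)
    next
      case 3
      then have "max X (max Y Z) = Z" using nn by simp
      moreover have "(X + Y + Z) / 4 \<le> Z / 2" using 3 by simp
      ultimately show ?thesis using 3 nn by (simp add: max_absorb1)
    next
      case 4
      then have "max X (max Y Z) / 2 \<le> (X + Y + Z) / 4" by simp
      then show ?thesis using 4 by (simp add: max_absorb2)
    qed
  qed
  have "(if bt x y z \<in> S then 1 else 0) = axis_region S \<bar>x\<bar> y z + axis_region S \<bar>y\<bar> x z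
     + axis_region S \<bar>z\<bar> x y + diag_region S \<bar>x\<bar> \<bar>y\<bar> \<bar>z\<bar>"
    unfolding bt_def axis_region_def diag_region_def by (rule region) (use ne in simp_all)
  then show ?thesis by (simp only: sum.distrib a d)
qed

section \<open>Contributions of a single region to the density\<close>

text \<open>The factor \<open>1 / (2 * r)\<close> is 1 for \<open>r = 1/2\<close>; the bracket is
  the fraction of a circle left by four arcs of length \<open>2 * half_arc\<close>. In
  \<open>diag_density\<close> the factor is \<open>2 / sqrt 3\<close> and there are three
  arcs.\<close>

definition axis_density :: "real \<Rightarrow> real" where
  "axis_density t = indicator {\<tau>\<^sub>0<..<1/2} t * (1 - 4 / pi * half_arc (sqrt 2 * t / sqrt (1 - 4 * t\<^sup>2)))"

definition diag_density :: "real \<Rightarrow> real" where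
  "diag_density t = indicator {\<tau>\<^sub>0<..<sqrt 3 / 4} t
     * (2 / sqrt 3 * (1 - 3 / pi * half_arc (sqrt 2 * t / sqrt (3 - 16 * t\<^sup>2))))"

lemma borel_measurable_densities [measurable]:
  "axis_density \<in> borel_measurable borel" "diag_density \<in> borel_measurable borel"
  unfolding axis_density_def diag_density_def by measurable

lemma integrable_half_arc_on:
  assumes [measurable]: "S \<in> sets borel" "g \<in> borel_measurable borel" and S: "S \<subseteq> {0<..<r::real}"
  shows "integrable lborel (\<lambda>t. indicator S t * half_arc (g t))"
    and "integrable lborel (\<lambda>t. indicator S t :: real)"
proof -
  have *: "emeasure lborel S < \<infinity>"
  proof -
    have "emeasure lborel S \<le> emeasure lborel {0..\<bar>r\<bar>}"
      using S by (intro emeasure_mono) (auto dest!: subsetD)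
    then show ?thesis by (simp add: le_less_trans)
  qed
  show 1: "integrable lborel (\<lambda>t. indicator S t :: real)"
    using * by (intro integrable_real_indicator) auto
  show "integrable lborel (\<lambda>t. indicator S t * half_arc (g t))"
    by (rule Bochner_Integration.integrable_bound[OF integrable_mult_right[OF 1, of pi]])
      (auto simp: indicator_def half_arc_bounds)
qed

context rotation_invariant begin

lemma parseval_triple:
  assumes "orthonormal n p" "orthonormal n q" "orthonormal p q"
  shows "AE u in N. (n \<bullet> u)\<^sup>2 + (p \<bullet> u)\<^sup>2 + (q \<bullet> u)\<^sup>2 = 1"
proof -
  have "q = n \<times> p \<or> q = - (n \<times> p)"
    using assms frame_third[of n p q] by (auto simp: orthonormal_def)
  then have q: "((n \<times> p) \<bullet> u)\<^sup>2 = (q \<bullet> u)\<^sup>2" for u by auto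
  show ?thesis
    using norm_1 by eventually_elim (use frame_parseval[OF assms(1)] in \<open>simp add: q\<close>)
qed

lemma triple_independent:
  assumes "orthonormal n p" "orthonormal n q" "orthonormal p q" and "a \<noteq> 0"
  shows "AE u in N. a * (n \<bullet> u) + b * (p \<bullet> u) + c * (q \<bullet> u) \<noteq> d"
proof -
  define v where "v = a *\<^sub>R n + b *\<^sub>R p + c *\<^sub>R q"
  have "n \<bullet> v = a"
    using assms by (simp add: v_def inner_simps orthonormal_def norm_eq_1)
  then have "v \<noteq> 0" using assms(4) by auto
  from AE_inner_neq[OF this, of d] show ?thesis
    by (simp add: v_def inner_simps)
qed

lemma integral_axis_region:
  assumes o: "orthonormal n p" "orthonormal n q" "orthonormal p q" and [measurable]: "S \<in> sets borel"
  shows "(\<integral>u. axis_region S (n \<bullet> u) (p \<bullet> u) (q \<bullet> u) \<partial>N) = (\<integral>t. indicator S t * axis_density t \<partial>lborel)"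
proof -
  define S' where "S' = S \<inter> {\<tau>\<^sub>0<..<1/2}"
  have S' [measurable]: "S' \<in> sets borel" and S'_sub: "S' \<subseteq> {0<..<1/2}"
    using tau0_sq(2) by (auto simp: S'_def)
  have ip: "n \<bullet> n = 1" "p \<bullet> p = 1" "q \<bullet> q = 1" "n \<bullet> p = 0" "n \<bullet> q = 0" "p \<bullet> q = 0" "q \<bullet> p = 0" and n: "norm n = 1"
    using o by (auto simp: orthonormal_def norm_eq_1 inner_commute)
  define g where "g t = half_arc (sqrt 2 * t / sqrt (1 - 4 * t\<^sup>2))" for t
  have g: "half_arc (1 / sqrt 2 * (t / (1/2)) / sqrt (1 - (t / (1/2))\<^sup>2)) = g t" for t
  proof -
    have "1 / sqrt 2 * (t / (1/2)) = 2 / sqrt 2 * t" by simp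
    also have "\<dots> = sqrt 2 * t" by (simp only: real_div_sqrt)
    finally show ?thesis by (simp only: g_def) (simp add: power_mult_distrib mult.commute)
  qed
  have ig: "integrable lborel (\<lambda>t. indicator S' t * g t)"
    unfolding g_def by (rule integrable_half_arc_on(1)[OF S' _ S'_sub]) measurable
  have i1: "integrable lborel (\<lambda>t. indicator S' t :: real)"
    by (rule integrable_half_arc_on(2)[OF S' borel_measurable_const S'_sub])
  define J where "J = (\<integral>t. indicator S' t * g t \<partial>lborel)"
  define K0 :: "real^3 \<Rightarrow> real" where "K0 u = (if (1/2) * (n \<bullet> u) \<in> S' then 1 else 0)" for u
  define K :: "real \<Rightarrow> real \<Rightarrow> real^3 \<Rightarrow> real" where
    "K b c u = (if (1/2) * (n \<bullet> u) \<in> S' \<and> n \<bullet> u < b * (p \<bullet> u) + c * (q \<bullet> u) then 1 else 0)" for b c u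
  have sect: "(\<integral>u. K b c u \<partial>N) = J / pi"
    if "b * b = 1" "c * c = 1" for b c
  proof -
    define r where "r = 1 / sqrt 2"
    have r: "r * r = 1 / 2" by (simp add: r_def)
    \<comment> \<open>\<open>w\<close> is the unit vector in the plane of \<open>p\<close> and
      \<open>q\<close> towards the middle of the sector; dividing the inequality by
      \<open>sqrt 2\<close> yields the slope \<open>1 / sqrt 2\<close>.\<close>
    define w where "w = r *\<^sub>R (b *\<^sub>R p + c *\<^sub>R q)"
    have "w \<bullet> w = (r * r) * (b * b + c * c)" "n \<bullet> w = 0"
      by (simp_all add: w_def inner_simps ip algebra_simps)
    then have w: "orthonormal n w" using n that by (simp add: r orthonormal_def norm_eq_1)
    have "n \<bullet> u < b * (p \<bullet> u) + c * (q \<bullet> u) \<longleftrightarrow> 1 / sqrt 2 * (n \<bullet> u) < w \<bullet> u" for u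
      by (simp add: w_def r_def inner_simps divide_less_cancel)
    then show ?thesis
      using integral_sector[OF w, of "1 / sqrt 2" "1/2" S'] S'_sub unfolding g by (simp add: J_def K_def)
  qed
  have int: "integrable N (K b c)" "integrable N K0" for b c
    unfolding K_def K0_def by (rule integrable_of_bool, measurable)+
  have "(\<integral>u. axis_region S (n \<bullet> u) (p \<bullet> u) (q \<bullet> u) \<partial>N) = (\<integral>u. K0 u
     - K 1 1 u
     - K 1 (-1) u
     - K (-1) 1 u
     - K (-1) (-1) u \<partial>N)"
  proof (rule integral_cong_AE)
    show "AE u in N. axis_region S (n \<bullet> u) (p \<bullet> u) (q \<bullet> u) = K0 u
     - K 1 1 u
     - K 1 (-1) u
     - K (-1) 1 u
     - K (-1) (-1) u"
      using parseval_triple[OF o] triple_independent[OF o, of 1 "-1" "-1" 0, OF one_neq_zero] triple_independent[OF o, of 1 "-1" 1 0, OF one_neq_zero]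
        triple_independent[OF o, of 1 1 "-1" 0, OF one_neq_zero] triple_independent[OF o, of 1 1 1 0, OF one_neq_zero]
        triple_independent[OF o, of 1 0 0 1, OF one_neq_zero]
    proof eventually_elim
      case (elim u)
      show ?case
        unfolding K_def K0_def S'_def mult_1 mult_minus1 add_uminus_conv_diff by (rule axis_region_split) (use elim in auto)
    qed
  qed (simp_all add: axis_region_def int borel_measurable_integrable)
  also have "\<dots> = (\<integral>t. indicator S' t \<partial>lborel) - J / pi - J / pi - J / pi - J / pi"
  proof -
    have "(\<integral>u. K0 u \<partial>N) = (\<integral>t. indicator S' t \<partial>lborel)"
      using integral_inner_mem[OF n, of "1/2" S'] S'_sub S' by (simp add: K0_def)
    then show ?thesis
      by (simp only: Bochner_Integration.integral_diff Bochner_Integration.integrable_diff int sect mult_1 mult_minus1_right minus_minus)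
  qed
  also have "\<dots> = (\<integral>t. indicator S' t \<partial>lborel) - 4 / pi * J" by simp
  also have "\<dots> = (\<integral>t. indicator S' t - 4 / pi * (indicator S' t * g t) \<partial>lborel)"
    by (simp only: Bochner_Integration.integral_diff[OF i1 integrable_mult_right[OF ig]] integral_mult_right_zero J_def)
  also have "\<dots> = (\<integral>t. indicator S t * axis_density t \<partial>lborel)"
    by (rule Bochner_Integration.integral_cong[OF refl]) (simp add: axis_density_def S'_def g_def indicator_def)
  finally show ?thesis .
qed

lemma integral_diag_region:
  assumes o: "orthonormal n p" "orthonormal n q" "orthonormal p q" and [measurable]: "S \<in> sets borel"
  shows "(\<integral>u. diag_region S (n \<bullet> u) (p \<bullet> u) (q \<bullet> u) \<partial>N) = (\<integral>t. indicator S t * diag_density t \<partial>lborel)"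
proof -
  define S' where "S' = S \<inter> {\<tau>\<^sub>0<..<sqrt 3 / 4}"
  have S' [measurable]: "S' \<in> sets borel" and S'_sub: "S' \<subseteq> {0<..<sqrt 3 / 4}"
    using tau0_sq(2) by (auto simp: S'_def)
  \<comment> \<open>The centre of the triangle; the brightness there is \<open>sqrt 3 / 4\<close>
    times the coordinate along \<open>m\<close>.\<close>
  define m where "m = (1 / sqrt 3) *\<^sub>R (n + p + q)"
  define g where "g t = half_arc (sqrt 2 * t / sqrt (3 - 16 * t\<^sup>2))" for t
  have g: "half_arc (1 / (2 * sqrt 2) * (t / (sqrt 3 / 4)) / sqrt (1 - (t / (sqrt 3 / 4))\<^sup>2)) = g t" for t
  proof -
    have "1 - (t / (sqrt 3 / 4))\<^sup>2 = (3 - 16 * t\<^sup>2) / 3" by (simp add: power_divide power_mult_distrib field_simps)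
    moreover have "1 / (2 * sqrt 2) * (t / (sqrt 3 / 4)) = 2 / sqrt 2 * t / sqrt 3" by simp
    then have "1 / (2 * sqrt 2) * (t / (sqrt 3 / 4)) = sqrt 2 * t / sqrt 3" by (simp only: real_div_sqrt)
    ultimately show ?thesis by (simp only: g_def) (simp add: real_sqrt_divide)
  qed
  have ig: "integrable lborel (\<lambda>t. indicator S' t * g t)"
    unfolding g_def by (rule integrable_half_arc_on(1)[OF S' _ S'_sub]) measurable
  have i1: "integrable lborel (\<lambda>t. indicator S' t :: real)"
    by (rule integrable_half_arc_on(2)[OF S' borel_measurable_const S'_sub])
  define J where "J = (\<integral>t. indicator S' t * g t \<partial>lborel)"
  have m_sum: "sqrt 3 / 4 * (m \<bullet> u) = (n \<bullet> u + p \<bullet> u + q \<bullet> u) / 4" for u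
    by (simp add: m_def inner_simps field_simps)
  have m: "norm m = 1"
  proof -
    have "m \<bullet> m = (1 / sqrt 3 * (1 / sqrt 3)) * 3"
      using o by (simp add: m_def inner_simps orthonormal_def norm_eq_1 inner_commute)
    then show ?thesis by (simp add: norm_eq_1)
  qed
  define K0 :: "real^3 \<Rightarrow> real" where "K0 u = (if sqrt 3 / 4 * (m \<bullet> u) \<in> S' then 1 else 0)" for u
  define K :: "real^3 \<Rightarrow> real^3 \<Rightarrow> real^3 \<Rightarrow> real^3 \<Rightarrow> real" where
    "K a b c u = (if sqrt 3 / 4 * (m \<bullet> u) \<in> S' \<and> b \<bullet> u + c \<bullet> u < a \<bullet> u then 1 else 0)" for a b c u
  have sect: "(\<integral>u. K a b c u \<partial>N) = 2 / (pi * sqrt 3) * J"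
    if o': "orthonormal a b" "orthonormal a c" "orthonormal b c" and m_def': "m = (1 / sqrt 3) *\<^sub>R (a + b + c)" for a b c
  proof -
    have ip: "a \<bullet> a = 1" "b \<bullet> b = 1" "c \<bullet> c = 1" "a \<bullet> b = 0" "a \<bullet> c = 0" "b \<bullet> c = 0" "b \<bullet> a = 0" "c \<bullet> a = 0" "c \<bullet> b = 0"
      using o' by (auto simp: orthonormal_def norm_eq_1 inner_commute)
    define r where "r = 1 / sqrt 6"
    have r: "r * r = 1 / 6" by (simp add: r_def)
    \<comment> \<open>\<open>w\<close> is the normalised component of \<open>a\<close> orthogonal to
      \<open>m\<close>. In coordinates, \<open>b + c < a\<close> is equivalent to
      \<open>(a + b + c) / 2 < 2 * a - b - c\<close>, which gives the slope
      \<open>1 / (2 * sqrt 2)\<close>.\<close>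
    define w where "w = r *\<^sub>R (2 *\<^sub>R a - b - c)"
    have "w \<bullet> w = (r * r) * 6" "m \<bullet> w = 0"
      by (simp_all add: w_def m_def' inner_simps ip algebra_simps)
    then have w: "orthonormal m w" using m by (simp add: r orthonormal_def norm_eq_1)
    have "b \<bullet> u + c \<bullet> u < a \<bullet> u \<longleftrightarrow> 1 / (2 * sqrt 2) * (m \<bullet> u) < w \<bullet> u" for u
    proof -
      have "1 / (2 * sqrt 2) * (m \<bullet> u) = (1 / sqrt 6) * ((a \<bullet> u + b \<bullet> u + c \<bullet> u) / 2)"
        by (simp add: m_def' inner_simps field_simps flip: real_sqrt_mult)
      moreover have "w \<bullet> u = (1 / sqrt 6) * (2 * (a \<bullet> u) - b \<bullet> u - c \<bullet> u)"
        by (simp add: w_def r_def inner_simps)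
      moreover have "0 < 1 / sqrt 6" by simp
      ultimately show ?thesis by (simp only: mult_less_cancel_left_pos) argo
    qed
    then show ?thesis
      using integral_sector[OF w, of "1 / (2 * sqrt 2)" "sqrt 3 / 4" S'] S'_sub unfolding g by (simp add: J_def K_def)
  qed
  have int: "integrable N (K a b c)" "integrable N K0" for a b c
    unfolding K_def K0_def by (rule integrable_of_bool, measurable)+
  have o2: "orthonormal p n" "orthonormal q n" "orthonormal q p"
    using o by (auto simp: orthonormal_def inner_commute)
  have "(\<integral>u. diag_region S (n \<bullet> u) (p \<bullet> u) (q \<bullet> u) \<partial>N) = (\<integral>u. K0 u
     - K n p q u
     - K p n q u
     - K q n p u \<partial>N)"
  proof (rule integral_cong_AE)
    show "AE u in N. diag_region S (n \<bullet> u) (p \<bullet> u) (q \<bullet> u) = K0 u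
     - K n p q u
     - K p n q u
     - K q n p u"
      using parseval_triple[OF o] triple_independent[OF o, of 1 "-1" "-1" 0, OF one_neq_zero] triple_independent[OF o, of 1 "-1" 1 0, OF one_neq_zero]
        triple_independent[OF o, of 1 1 "-1" 0, OF one_neq_zero] triple_independent[OF o, of 1 1 1 "sqrt 3", OF one_neq_zero]
    proof eventually_elim
      case (elim u)
      show ?case
        unfolding K_def K0_def S'_def m_sum by (rule diag_region_split) (use elim in auto)
    qed
  qed (simp_all add: diag_region_def int borel_measurable_integrable)
  also have "\<dots> = (\<integral>u. K0 u \<partial>N)
      - 2 / (pi * sqrt 3) * J - 2 / (pi * sqrt 3) * J - 2 / (pi * sqrt 3) * J"
  proof -
    have 1: "m = (1 / sqrt 3) *\<^sub>R (p + n + q)" "m = (1 / sqrt 3) *\<^sub>R (q + n + p)"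
      by (simp_all add: m_def add_ac)
    show ?thesis
      by (simp only: Bochner_Integration.integral_diff Bochner_Integration.integrable_diff int
          sect[OF o m_def] sect[OF o2(1) o(3,2) 1(1)] sect[OF o2(2,3) o(1) 1(2)])
  qed
  also have "(\<integral>u. K0 u \<partial>N) = 2 / sqrt 3 * (\<integral>t. indicator S' t \<partial>lborel)"
    using integral_inner_mem[OF m, of "sqrt 3 / 4" S'] S'_sub S' by (simp add: K0_def)
  also have "2 / sqrt 3 * (\<integral>t. indicator S' t \<partial>lborel) - 2 / (pi * sqrt 3) * J - 2 / (pi * sqrt 3) * J - 2 / (pi * sqrt 3) * J
      = 2 / sqrt 3 * (\<integral>t. indicator S' t \<partial>lborel) - 6 / (pi * sqrt 3) * J" by simp
  also have "\<dots> = (\<integral>t. 2 / sqrt 3 * indicator S' t - 6 / (pi * sqrt 3) * (indicator S' t * g t) \<partial>lborel)"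
    by (simp only: Bochner_Integration.integral_diff[OF integrable_mult_right[OF i1] integrable_mult_right[OF ig]]
        integral_mult_right_zero J_def)
  also have "\<dots> = (\<integral>t. indicator S t * diag_density t \<partial>lborel)"
    by (rule Bochner_Integration.integral_cong[OF refl]) (auto simp: diag_density_def S'_def g_def algebra_simps split: split_indicator)
  finally show ?thesis .
qed

end

subsection \<open>The density\<close>

lemma tau_order: "\<tau>\<^sub>0 < \<tau>\<^sub>1" "\<tau>\<^sub>1 < \<tau>\<^sub>2" "\<tau>\<^sub>2 < \<tau>\<^sub>3"
  and tau_sq: "\<tau>\<^sub>1\<^sup>2 = 1 / 6" "\<tau>\<^sub>2\<^sup>2 = 3 / 16" "\<tau>\<^sub>3\<^sup>2 = 1 / 4"
  and tau_pos: "0 < \<tau>\<^sub>1" "0 < \<tau>\<^sub>2" "0 < \<tau>\<^sub>3"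
proof -
  show sq: "\<tau>\<^sub>1\<^sup>2 = 1 / 6" "\<tau>\<^sub>2\<^sup>2 = 3 / 16" "\<tau>\<^sub>3\<^sup>2 = 1 / 4"
    and pos: "0 < \<tau>\<^sub>1" "0 < \<tau>\<^sub>2" "0 < \<tau>\<^sub>3"
    by (simp_all add: \<tau>\<^sub>1_def \<tau>\<^sub>2_def \<tau>\<^sub>3_def power_divide)
  show "\<tau>\<^sub>0 < \<tau>\<^sub>1" "\<tau>\<^sub>1 < \<tau>\<^sub>2" "\<tau>\<^sub>2 < \<tau>\<^sub>3"
    using power2_less_imp_less[of \<tau>\<^sub>0 \<tau>\<^sub>1] power2_less_imp_less[of \<tau>\<^sub>1 \<tau>\<^sub>2]
      power2_less_imp_less[of \<tau>\<^sub>2 \<tau>\<^sub>3] sq pos tau0_sq by simp_all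
qed

lemma half_arc_less:
  assumes "0 < c" "c \<le> pi" "cos c < x"
  shows "half_arc x < c"
proof -
  have "cos c < max (-1) (min 1 x)"
    using assms cos_monotone_0_pi[of 0 c] by (simp add: max_def min_def)
  then have "half_arc x < arccos (cos c)"
    unfolding half_arc_def by (intro arccos_less_arccos) auto
  then show ?thesis using assms by (simp add: arccos_cos)
qed

text \<open>At \<open>\<tau>\<^sub>0\<close> the argument of \<open>half_arc\<close> is
  \<open>cos (pi / 4)\<close>: the four arcs just fill the circle. Above this level they leave a
  gap.\<close>

lemma axis_density_pos:
  assumes "\<tau>\<^sub>0 < t" "t < 1/2"
  shows "0 < axis_density t"
proof -
  have t: "0 < t" using assms tau0_sq by linarith
  have "\<tau>\<^sub>0\<^sup>2 < t\<^sup>2" using assms tau0_sq by (intro power_strict_mono) auto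
  moreover have "t\<^sup>2 < (1/2)\<^sup>2" using assms t by (intro power_strict_mono) auto
  ultimately have t2: "1 - 4 * t\<^sup>2 < 4 * t\<^sup>2" "0 < 1 - 4 * t\<^sup>2" by (simp_all add: tau0_sq power_divide)
  have "sqrt (1 - 4 * t\<^sup>2) < 2 * t"
    by (rule real_less_lsqrt) (use t t2 in \<open>simp_all add: power_mult_distrib\<close>)
  then have "sqrt 2 / 2 * sqrt (1 - 4 * t\<^sup>2) < sqrt 2 / 2 * (2 * t)" by (intro mult_strict_left_mono) auto
  then have "cos (pi / 4) < sqrt 2 * t / sqrt (1 - 4 * t\<^sup>2)"
    using t2 by (simp add: cos_45 pos_less_divide_eq)
  then have "half_arc (sqrt 2 * t / sqrt (1 - 4 * t\<^sup>2)) < pi / 4"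
    by (intro half_arc_less) auto
  then show ?thesis using assms by (simp add: axis_density_def field_simps)
qed

text \<open>Three arcs of half-angle \<open>pi / 3\<close> fill the circle at
  \<open>\<tau>\<^sub>0\<close>, and they shrink above it.\<close>

lemma diag_density_nonneg: "0 \<le> diag_density t"
proof (cases "t \<in> {\<tau>\<^sub>0<..<sqrt 3 / 4}")
  case True
  then have t: "0 < t" using tau0_sq by auto
  have "\<tau>\<^sub>0\<^sup>2 < t\<^sup>2" using True tau0_sq by (intro power_strict_mono) auto
  moreover have "t\<^sup>2 < (sqrt 3 / 4)\<^sup>2" using True t by (intro power_strict_mono) auto
  ultimately have t2: "3 - 16 * t\<^sup>2 < 8 * t\<^sup>2" "0 < 3 - 16 * t\<^sup>2" by (simp_all add: tau0_sq power_divide)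
  have "sqrt (3 - 16 * t\<^sup>2) < sqrt ((2 * sqrt 2 * t)\<^sup>2)" using t2 by (simp add: power_mult_distrib)
  then have "sqrt (3 - 16 * t\<^sup>2) < 2 * sqrt 2 * t" using t by simp
  then have "cos (pi / 3) < sqrt 2 * t / sqrt (3 - 16 * t\<^sup>2)"
    using t2 by (simp add: cos_60 pos_less_divide_eq)
  then have "half_arc (sqrt 2 * t / sqrt (3 - 16 * t\<^sup>2)) < pi / 3"
    by (intro half_arc_less) auto
  then show ?thesis using True by (simp add: diag_density_def field_simps)
qed (simp add: diag_density_def)

text \<open>The coefficients count the six squares and the eight triangles. The angle
  \<open>\<eta>\<close> is the complement of the half-arc of a square, which accounts for the
  different signs of \<open>\<eta>\<close> and \<open>\<delta>\<close>.\<close>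

lemma f_BT_eq: "f_BT t = 6 * axis_density t + 8 * diag_density t"
proof -
  have tau: "\<tau>\<^sub>2 = sqrt 3 / 4" "\<tau>\<^sub>3 = 1 / 2" by (simp_all add: \<tau>\<^sub>2_def \<tau>\<^sub>3_def)
  consider "t < \<tau>\<^sub>0" | "t = \<tau>\<^sub>0" | "\<tau>\<^sub>0 < t" "t < \<tau>\<^sub>1" | "\<tau>\<^sub>1 \<le> t" "t < \<tau>\<^sub>3" | "\<tau>\<^sub>3 \<le> t" by linarith
  then show ?thesis
  proof cases
    case 1
    then show ?thesis by (simp add: f_BT_def axis_density_def diag_density_def)
  next
    case 2
    \<comment> \<open>The open intervals of the two densities omit \<open>\<tau>\<^sub>0\<close>,
      whereas \<open>f_BT\<close> uses its second branch there; both of its brackets vanish.\<close>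
    have e: "sqrt 2 * \<tau>\<^sub>0 = 1/2" "sqrt (1 - 4 * \<tau>\<^sub>0\<^sup>2) = 1 / sqrt 2" "sqrt (3 - 16 * \<tau>\<^sub>0\<^sup>2) = 1"
      by (simp_all add: \<tau>\<^sub>0_def tau0_sq[unfolded \<tau>\<^sub>0_def] real_sqrt_divide)
    have "\<eta> \<tau>\<^sub>0 = arcsin (sin (pi / 4))" "\<delta> \<tau>\<^sub>0 = arccos (cos (pi / 3))"
      unfolding \<eta>_def \<delta>_def e sin_45 cos_60 by simp_all
    then have ed: "\<eta> \<tau>\<^sub>0 = pi / 4" "\<delta> \<tau>\<^sub>0 = pi / 3"
      by (simp_all add: arcsin_sin arccos_cos)
    show ?thesis using tau_order by (simp add: 2 ed f_BT_def axis_density_def diag_density_def)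
  next
    case 3
    have t: "0 < t" using 3 tau0_sq by linarith
    have "t\<^sup>2 < \<tau>\<^sub>1\<^sup>2" using 3 t by (intro power_strict_mono) auto
    then have t2: "t\<^sup>2 < 1 / 6" by (simp add: tau_sq)
    define x y where "x = sqrt 2 * t / sqrt (1 - 4 * t\<^sup>2)" and "y = sqrt 2 * t / sqrt (3 - 16 * t\<^sup>2)"
    \<comment> \<open>Both \<open>2 * t^2 \<le> 1 - 4 * t^2\<close> and
      \<open>2 * t^2 \<le> 3 - 16 * t^2\<close> amount to \<open>t^2 \<le> 1 / 6\<close>, so below
      \<open>\<tau>\<^sub>1\<close> neither argument is clipped.\<close>
    have "sqrt ((sqrt 2 * t)\<^sup>2) \<le> sqrt (1 - 4 * t\<^sup>2)" "sqrt ((sqrt 2 * t)\<^sup>2) \<le> sqrt (3 - 16 * t\<^sup>2)"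
      using t2 by (simp_all add: power_mult_distrib)
    then have "0 \<le> x" "x \<le> 1" "0 \<le> y" "y \<le> 1"
      using t t2 by (simp_all add: x_def y_def divide_le_eq_1)
    then have "half_arc x = pi / 2 - \<eta> t" "half_arc y = \<delta> t"
      by (simp_all add: half_arc_eq_arccos arccos_arcsin_eq \<eta>_def \<delta>_def x_def y_def)
    moreover have "t < \<tau>\<^sub>2" "t < \<tau>\<^sub>3" using 3 tau_order by linarith+
    ultimately have "6 * axis_density t + 8 * diag_density t
       = 6 * (1 - 4 / pi * (pi / 2 - \<eta> t)) + 8 * (2 / sqrt 3 * (1 - 3 / pi * \<delta> t))"
      using 3 by (simp add: axis_density_def diag_density_def x_def y_def flip: tau)
    also have "\<dots> = 24 / pi * (\<eta> t - pi / 4) + 48 / (pi * sqrt 3) * (pi / 3 - \<delta> t)"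
      by (simp add: field_simps)
    finally show ?thesis using 3 by (simp add: f_BT_def)
  next
    case 4
    have t: "0 < t" "\<tau>\<^sub>0 < t" using 4 tau_pos tau_order by linarith+
    have "\<tau>\<^sub>1\<^sup>2 \<le> t\<^sup>2" using 4 tau_pos by (intro power_mono) auto
    moreover have "t\<^sup>2 < \<tau>\<^sub>3\<^sup>2" using 4 t by (intro power_strict_mono) auto
    ultimately have t2: "1 / 6 \<le> t\<^sup>2" "t\<^sup>2 < 1 / 4" by (simp_all add: tau_sq)
    have "sqrt (1 - 4 * t\<^sup>2) \<le> sqrt ((sqrt 2 * t)\<^sup>2)" using t2 by (simp add: power_mult_distrib)
    then have "1 \<le> sqrt 2 * t / sqrt (1 - 4 * t\<^sup>2)"
      using t t2 by (simp add: le_divide_eq_1)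
    then have a: "axis_density t = 1" using t 4 by (simp add: axis_density_def half_arc_ge_1 tau)
    show ?thesis
    proof (cases "t < \<tau>\<^sub>2")
      case True
      have "t\<^sup>2 < \<tau>\<^sub>2\<^sup>2" using True t by (intro power_strict_mono) auto
      then have "t\<^sup>2 < 3 / 16" by (simp add: tau_sq)
      have "sqrt (3 - 16 * t\<^sup>2) \<le> sqrt ((sqrt 2 * t)\<^sup>2)" using t2 by (simp add: power_mult_distrib)
      then have "1 \<le> sqrt 2 * t / sqrt (3 - 16 * t\<^sup>2)"
        using t \<open>t\<^sup>2 < 3 / 16\<close> by (simp add: le_divide_eq_1)
      then have "diag_density t = 2 / sqrt 3"
        using t True by (simp add: diag_density_def half_arc_ge_1 tau)
      then show ?thesis using a t 4 True by (simp add: f_BT_def)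
    next
      case False
      then have "diag_density t = 0" by (simp add: diag_density_def tau)
      then show ?thesis using a t 4 False by (simp add: f_BT_def)
    qed
  next
    case 5
    then have "\<tau>\<^sub>2 < t" "\<not> t < \<tau>\<^sub>0" "\<not> t < \<tau>\<^sub>1" "\<not> t < \<tau>\<^sub>2" using tau_order by linarith+
    then show ?thesis using 5 by (simp add: f_BT_def axis_density_def diag_density_def flip: tau)
  qed
qed

lemma f_BT_nonneg: "0 \<le> f_BT t"
proof -
  have "0 \<le> axis_density t"
    using axis_density_pos[of t] by (cases "t \<in> {\<tau>\<^sub>0<..<1/2}") (auto simp: axis_density_def less_imp_le)
  then show ?thesis using diag_density_nonneg[of t] by (simp add: f_BT_eq)
qed

lemma f_BT_pos: "\<tau>\<^sub>0 < t \<Longrightarrow> t < \<tau>\<^sub>3 \<Longrightarrow> 0 < f_BT t"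
  using axis_density_pos[of t] diag_density_nonneg[of t] by (simp add: f_BT_eq \<tau>\<^sub>3_def)

lemma borel_measurable_f_BT [measurable]: "f_BT \<in> borel_measurable borel"
  using borel_measurable_densities by (subst f_BT_eq[abs_def]) measurable

section \<open>Support and integrability of the density\<close>

text \<open>Positivity on the open interval suffices: a neighbourhood of any point of the closed
  interval, end points included, contains a small interval on which the density is positive.\<close>

lemma law_support_f_BT: "law_support (density lborel (\<lambda>t. ennreal (f_BT t))) = {\<tau>\<^sub>0..\<tau>\<^sub>3}"
proof -
  let ?\<nu> = "density lborel (\<lambda>t. ennreal (f_BT t))"
  have pt: "ennreal (f_BT t) * indicator W t = 0 \<longleftrightarrow> (t \<in> W \<longrightarrow> f_BT t = 0)" for t W
    using f_BT_nonneg[of t] by (cases "t \<in> W") (simp_all add: ennreal_eq_0_iff order_antisym_conv)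
  have null: "emeasure ?\<nu> W = 0 \<longleftrightarrow> (AE t in lborel. t \<in> W \<longrightarrow> f_BT t = 0)" if "open W" for W
  proof -
    have "emeasure ?\<nu> W = (\<integral>\<^sup>+ t. ennreal (f_BT t) * indicator W t \<partial>lborel)"
      by (rule emeasure_density) (use that in auto)
    moreover have "(\<integral>\<^sup>+ t. ennreal (f_BT t) * indicator W t \<partial>lborel) = 0
        \<longleftrightarrow> (AE t in lborel. ennreal (f_BT t) * indicator W t = 0)"
      by (rule nn_integral_0_iff_AE) (use that in auto)
    ultimately show ?thesis unfolding pt by simp
  qed
  have "x \<in> law_support ?\<nu>" if x: "x \<in> {\<tau>\<^sub>0..\<tau>\<^sub>3}" for x
    unfolding law_support_def
  proof (intro CollectI allI impI)
    fix W assume W: "open W \<and> x \<in> W"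
    have lt: "\<tau>\<^sub>0 < \<tau>\<^sub>3" using tau_order by linarith
    have "x \<in> closure {\<tau>\<^sub>0<..<\<tau>\<^sub>3}" using x lt by simp
    then have "W \<inter> {\<tau>\<^sub>0<..<\<tau>\<^sub>3} \<noteq> {}" using W by (meson closure_iff_nhds_not_empty disjoint_iff order_refl)
    then obtain y where y: "y \<in> W \<inter> {\<tau>\<^sub>0<..<\<tau>\<^sub>3}" by blast
    have "open (W \<inter> {\<tau>\<^sub>0<..<\<tau>\<^sub>3})" using W by auto
    then obtain e where e: "e > 0" "ball y e \<subseteq> W \<inter> {\<tau>\<^sub>0<..<\<tau>\<^sub>3}" using y by (rule openE)
    show "emeasure ?\<nu> W > 0"
    proof (rule ccontr)
      assume "\<not> emeasure ?\<nu> W > 0"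
      then have "AE t in lborel. t \<in> W \<longrightarrow> f_BT t = 0" using null W by auto
      then have "AE t in lborel. t \<notin> {y - e<..<y + e}"
      proof eventually_elim
        case (elim t)
        show ?case
        proof
          assume "t \<in> {y - e<..<y + e}"
          then have "t \<in> ball y e" by (auto simp: dist_real_def)
          then have "t \<in> W" "0 < f_BT t" using e f_BT_pos by auto
          then show False using elim by simp
        qed
      qed
      then have "emeasure lborel {y - e<..<y + e} = 0"
        by (subst (asm) AE_iff_null_sets[symmetric]) auto
      then show False using e by simp
    qed
  qed
  moreover have "x \<notin> law_support ?\<nu>" if x: "x \<notin> {\<tau>\<^sub>0..\<tau>\<^sub>3}" for x
  proof -
    have "f_BT t = 0" if "t \<notin> {\<tau>\<^sub>0..\<tau>\<^sub>3}" for t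
      using that tau_order by (auto simp: f_BT_def)
    then have "emeasure ?\<nu> (- {\<tau>\<^sub>0..\<tau>\<^sub>3}) = 0" by (subst null) auto
    moreover have "open (- {\<tau>\<^sub>0..\<tau>\<^sub>3})" by auto
    ultimately show ?thesis using x unfolding law_support_def by (metis (mono_tags, lifting) ComplI less_irrefl mem_Collect_eq)
  qed
  ultimately show ?thesis by blast
qed

lemma integrable_f_BT: "integrable lborel axis_density" "integrable lborel diag_density" "integrable lborel f_BT"
proof -
  have sub: "{\<tau>\<^sub>0<..<1/2} \<subseteq> {0<..<1/2}" "{\<tau>\<^sub>0<..<sqrt 3 / 4} \<subseteq> {0<..<sqrt 3 / 4}"
    using tau0_sq(2) by auto
  have "integrable lborel (\<lambda>t. indicator {\<tau>\<^sub>0<..<1/2} t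
      - 4 / pi * (indicator {\<tau>\<^sub>0<..<1/2} t * half_arc (sqrt 2 * t / sqrt (1 - 4 * t\<^sup>2))))"
    by (intro Bochner_Integration.integrable_diff integrable_mult_right integrable_half_arc_on(1)[OF _ _ sub(1)]
        integrable_half_arc_on(2)[OF _ borel_measurable_const sub(1)]) measurable
  then show 1: "integrable lborel axis_density"
    by (rule Bochner_Integration.integrable_cong[OF refl, THEN iffD1, rotated]) (simp add: axis_density_def algebra_simps)
  have "integrable lborel (\<lambda>t. 2 / sqrt 3 * (indicator {\<tau>\<^sub>0<..<sqrt 3 / 4} t
      - 3 / pi * (indicator {\<tau>\<^sub>0<..<sqrt 3 / 4} t * half_arc (sqrt 2 * t / sqrt (3 - 16 * t\<^sup>2)))))"
    by (intro Bochner_Integration.integrable_diff integrable_mult_right integrable_half_arc_on(1)[OF _ _ sub(2)]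
        integrable_half_arc_on(2)[OF _ borel_measurable_const sub(2)]) measurable
  then show 2: "integrable lborel diag_density"
    by (rule Bochner_Integration.integrable_cong[OF refl, THEN iffD1, rotated]) (simp add: diag_density_def algebra_simps)
  have "integrable lborel (\<lambda>t. 6 * axis_density t + 8 * diag_density t)"
    using 1 2 by simp
  then show "integrable lborel f_BT" by (simp add: f_BT_eq[abs_def])
qed

subsection \<open>The law of the brightness\<close>

lemma orthonormal_signs:
  assumes "orthonormal n p" "s \<in> {1, -1}" "s' \<in> {1, -1}"
  shows "orthonormal (s *\<^sub>R n) (s' *\<^sub>R p)"
  using assms by (auto simp: orthonormal_def)

context rotation_invariant begin

text \<open>Signs and permutations of an orthonormal frame give orthonormal frames again, so all six
  axis integrals have one value \<open>A\<close> and all eight diagonal ones one value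
  \<open>D\<close>.\<close>

lemma integral_bt:
  assumes np: "orthonormal n p" and [measurable]: "S \<in> sets borel"
  shows "(\<integral>u. (if bt (n \<bullet> u) (p \<bullet> u) ((n \<times> p) \<bullet> u) \<in> S then 1 else 0) \<partial>N)
    = (\<integral>t. indicator S t * f_BT t \<partial>lborel)"
proof -
  define q where "q = n \<times> p"
  have "(norm q)\<^sup>2 = 1\<^sup>2"
    using norm_cross_dot[of n p] np by (simp add: q_def orthonormal_def)
  then have "norm q = 1" by (rule power2_eq_imp_eq) simp_all
  then have o: "orthonormal n p" "orthonormal n q" "orthonormal p q"
    using np by (auto simp: orthonormal_def q_def dot_cross_self)
  then have o': "orthonormal p n" "orthonormal q n" "orthonormal q p"
    by (auto simp: orthonormal_def inner_commute)
  define A where "A = (\<integral>t. indicator S t * axis_density t \<partial>lborel)"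
  define D where "D = (\<integral>t. indicator S t * diag_density t \<partial>lborel)"
  have vA: "(\<integral>u. axis_region S (s * (a \<bullet> u)) (b \<bullet> u) (c \<bullet> u) \<partial>N) = A"
    if "orthonormal a b" "orthonormal a c" "orthonormal b c" "s \<in> {1, -1}" for a b c s
    using integral_axis_region[of "s *\<^sub>R a" b c S] that
      orthonormal_signs[OF that(1,4), of 1] orthonormal_signs[OF that(2,4), of 1] by (simp add: A_def)
  have vD: "(\<integral>u. diag_region S (s * (n \<bullet> u)) (s' * (p \<bullet> u)) (s'' * (q \<bullet> u)) \<partial>N) = D"
    if "s \<in> {1, -1}" "s' \<in> {1, -1}" "s'' \<in> {1, -1}" for s s' s''
    using integral_diag_region[OF orthonormal_signs[OF o(1) that(1,2)] orthonormal_signs[OF o(2) that(1,3)]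
        orthonormal_signs[OF o(3) that(2,3)], of S] by (simp add: D_def)
  have int: "integrable N (\<lambda>u. axis_region S (s * (a \<bullet> u)) (b \<bullet> u) (c \<bullet> u))"
    "integrable N (\<lambda>u. diag_region S (s * (a \<bullet> u)) (s' * (b \<bullet> u)) (s'' * (c \<bullet> u)))" for a b c s s' s''
    unfolding axis_region_def diag_region_def by (rule integrable_of_bool, measurable)+
  have sum2: "(\<Sum>s\<in>{1, -1}. h s) = h 1 + h (-1)" for h :: "real \<Rightarrow> real" by simp
  have signs: "1 \<in> {1, -1 :: real}" "-1 \<in> {1, -1 :: real}" by auto
  define F where "F u = (\<Sum>s\<in>{1, -1}. axis_region S (s * (n \<bullet> u)) (p \<bullet> u) (q \<bullet> u)
     + axis_region S (s * (p \<bullet> u)) (n \<bullet> u) (q \<bullet> u) + axis_region S (s * (q \<bullet> u)) (n \<bullet> u) (p \<bullet> u))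
     + (\<Sum>s\<in>{1, -1}. \<Sum>s'\<in>{1, -1}. \<Sum>s''\<in>{1, -1}. diag_region S (s * (n \<bullet> u)) (s' * (p \<bullet> u)) (s'' * (q \<bullet> u)))" for u
  have "(\<integral>u. (if bt (n \<bullet> u) (p \<bullet> u) (q \<bullet> u) \<in> S then 1 else 0) \<partial>N) = (\<integral>u. F u \<partial>N)"
  proof (rule integral_cong_AE)
    show "AE u in N. (if bt (n \<bullet> u) (p \<bullet> u) (q \<bullet> u) \<in> S then 1 else 0) = F u"
      using triple_independent[OF o, of 1 "-1" "-1" 0, OF one_neq_zero] triple_independent[OF o, of 1 "-1" 1 0, OF one_neq_zero]
        triple_independent[OF o, of 1 1 "-1" 0, OF one_neq_zero] triple_independent[OF o, of 1 1 1 0, OF one_neq_zero]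
    proof eventually_elim
      case (elim u)
      show ?case unfolding F_def
        by (rule bt_decomposition) (use elim in linarith)+
    qed
    show "F \<in> borel_measurable N"
      unfolding F_def by (intro borel_measurable_add borel_measurable_sum borel_measurable_integrable int)
  qed (simp add: bt_def)
  also have "\<dots> = 6 * A + 8 * D"
    unfolding F_def sum2
    by (simp only: Bochner_Integration.integral_add Bochner_Integration.integrable_add int
        vA[OF o signs(1)] vA[OF o signs(2)] vA[OF o'(1) o(3,2) signs(1)] vA[OF o'(1) o(3,2) signs(2)]
        vA[OF o'(2,3) o(1) signs(1)] vA[OF o'(2,3) o(1) signs(2)]
        vD[OF signs(1) signs(1) signs(1)] vD[OF signs(1) signs(1) signs(2)] vD[OF signs(1) signs(2) signs(1)]
        vD[OF signs(1) signs(2) signs(2)] vD[OF signs(2) signs(1) signs(1)] vD[OF signs(2) signs(1) signs(2)]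
        vD[OF signs(2) signs(2) signs(1)] vD[OF signs(2) signs(2) signs(2)])
  also have "\<dots> = (\<integral>t. 6 * (indicator S t * axis_density t) + 8 * (indicator S t * diag_density t) \<partial>lborel)"
  proof -
    have "integrable lborel (\<lambda>t. indicator S t * axis_density t)" "integrable lborel (\<lambda>t. indicator S t * diag_density t)"
      using integrable_mult_indicator[OF _ integrable_f_BT(1), of S] integrable_mult_indicator[OF _ integrable_f_BT(2), of S]
      by simp_all
    then show ?thesis unfolding A_def D_def
      by (simp only: Bochner_Integration.integral_add integrable_mult_right integral_mult_right_zero)
  qed
  also have "\<dots> = (\<integral>t. indicator S t * f_BT t \<partial>lborel)"
    by (rule Bochner_Integration.integral_cong[OF refl]) (simp add: f_BT_eq algebra_simps)
  finally show ?thesis by (simp add: q_def)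
qed

end

section \<open>From the sphere to the ambient space\<close>

lemma uniform_on_sphere_norm:
  assumes "uniform_on_sphere M U" "\<omega> \<in> space M"
  shows "norm (U \<omega>) = 1"
proof -
  have "U \<omega> \<in> space sphere_algebra"
    using assms measurable_space unfolding uniform_on_sphere_def by metis
  then show ?thesis by (simp add: sphere_algebra_def space_restrict_space)
qed

lemma uniform_on_sphere_measurable:
  assumes "uniform_on_sphere M U"
  shows "U \<in> M \<rightarrow>\<^sub>M borel"
  using assms unfolding uniform_on_sphere_def sphere_algebra_def
  by (auto simp: measurable_restrict_space2_iff)

text \<open>The law on \<open>real^3\<close> is the image of the law on the sphere under the
  inclusion, and the inclusion commutes with rotations.\<close>

lemma uniform_on_sphere_invariant:
  assumes "prob_space M" and U: "uniform_on_sphere M U"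
  shows "rotation_invariant (distr M borel U)"
proof -
  interpret prob_space M by fact
  have Um [measurable]: "U \<in> M \<rightarrow>\<^sub>M borel" by (rule uniform_on_sphere_measurable[OF U])
  have Us: "U \<in> M \<rightarrow>\<^sub>M sphere_algebra" using U by (simp add: uniform_on_sphere_def)
  have idm: "(\<lambda>x. x) \<in> sphere_algebra \<rightarrow>\<^sub>M borel"
    unfolding sphere_algebra_def by (rule measurable_restrict_space1) simp
  show ?thesis
  proof (intro rotation_invariant.intro rotation_invariant_axioms.intro)
    show "prob_space (distr M borel U)" by (rule prob_space_distr) simp
    show "sets (distr M borel U) = sets borel" by simp
    show "AE u in distr M borel U. norm u = 1"
      using uniform_on_sphere_norm[OF U] by (subst AE_distr_iff) auto
    fix Q :: "real^3^3" assume Q: "rotation_matrix Q"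
    have Qb [measurable]: "(*v) Q \<in> borel \<rightarrow>\<^sub>M borel"
      by (intro borel_measurable_continuous_onI linear_continuous_on matrix_vector_mul_bounded_linear)
    have nQ: "norm (Q *v x) = norm x" for x
      using Q orthogonal_transformation_matrix[of "(*v) Q"] by (simp add: rotation_matrix_def orthogonal_transformation)
    have Qs: "(*v) Q \<in> sphere_algebra \<rightarrow>\<^sub>M sphere_algebra"
      unfolding sphere_algebra_def
      by (rule measurable_restrict_space3) (use Qb in \<open>auto simp: nQ\<close>)
    have inv: "distr (distr M sphere_algebra U) sphere_algebra ((*v) Q) = distr M sphere_algebra U"
      using U Q by (simp add: uniform_on_sphere_def rotation_invariant_prob_def)
    have "distr (distr M borel U) borel ((*v) Q) = distr M borel (\<lambda>\<omega>. Q *v U \<omega>)"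
      by (subst distr_distr) (auto simp: comp_def)
    also have "\<dots> = distr (distr (distr M sphere_algebra U) sphere_algebra ((*v) Q)) borel (\<lambda>x. x)"
      using Us Qs idm by (simp add: distr_distr comp_def)
    also have "\<dots> = distr M borel U"
      unfolding inv using Us idm by (simp add: distr_distr comp_def)
    finally show "distr (distr M borel U) borel ((*v) Q) = distr M borel U" .
  qed
qed

theorem theorem5p4:
  fixes M :: "'a measure" and U :: "'a \<Rightarrow> real^3" and T :: "(real^3) set"
    and B :: "'a \<Rightarrow> real"
  assumes "prob_space M"
    and "uniform_on_sphere M U"
    and "unit_regular_tetrahedron T"
    and "B = (\<lambda>\<omega>. brightness T (U \<omega>))"
  shows "B \<in> borel_measurable M
    \<and> absolutely_continuous lborel (distr M borel B)
    \<and> law_support (distr M borel B) = {\<tau>\<^sub>0..\<tau>\<^sub>3}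
    \<and> (\<forall>t. 0 \<le> f_BT t)
    \<and> distributed M lborel B (\<lambda>t. ennreal (f_BT t))"
proof -
  interpret prob_space M by fact
  interpret N: rotation_invariant "distr M borel U"
    by (rule uniform_on_sphere_invariant[OF assms(1,2)])
  have [measurable]: "U \<in> M \<rightarrow>\<^sub>M borel" by (rule uniform_on_sphere_measurable[OF assms(2)])
  obtain n p where np: "orthonormal n p"
    and br: "\<And>u. norm u = 1 \<Longrightarrow> brightness T u
      = max (max \<bar>n \<bullet> u\<bar> (max \<bar>p \<bullet> u\<bar> \<bar>(n \<times> p) \<bullet> u\<bar>) / 2)
          ((\<bar>n \<bullet> u\<bar> + \<bar>p \<bullet> u\<bar> + \<bar>(n \<times> p) \<bullet> u\<bar>) / 4)"
    using brightness_unit_regular_tetrahedron[OF assms(3)] by metis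
  define G where "G u = bt (n \<bullet> u) (p \<bullet> u) ((n \<times> p) \<bullet> u)" for u
  have [measurable]: "G \<in> borel_measurable borel" unfolding G_def bt_def by measurable
  \<comment> \<open>\<open>G\<close> is Borel on all of \<open>real^3\<close> and agrees with the
    brightness on unit vectors, so \<open>B\<close> inherits measurability from \<open>G\<close>
    composed with \<open>U\<close>.\<close>
  have BG: "B \<omega> = G (U \<omega>)" if "\<omega> \<in> space M" for \<omega>
    unfolding assms(4) G_def bt_def by (rule br) (rule uniform_on_sphere_norm[OF assms(2) that])
  have B: "B \<in> borel_measurable M"
    by (subst measurable_cong[OF BG]) measurable
  have law: "distr M lborel B = density lborel (\<lambda>t. ennreal (f_BT t))"
  proof (rule measure_eqI)
    fix S assume "S \<in> sets (distr M lborel B)"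
    then have S [measurable]: "S \<in> sets borel" by simp
    have "emeasure (distr M lborel B) S = emeasure M (B -` S \<inter> space M)"
      using B by (subst emeasure_distr) auto
    \<comment> \<open>Real-valued integrals are used here because the decomposition behind
      \<open>integral_bt\<close> subtracts indicators.\<close>
    also have "\<dots> = ennreal (\<integral>\<omega>. indicator (B -` S \<inter> space M) \<omega> \<partial>M)"
      using measurable_sets[OF B S] by (simp add: emeasure_eq_measure)
    also have "(\<integral>\<omega>. indicator (B -` S \<inter> space M) \<omega> \<partial>M) = (\<integral>\<omega>. (if G (U \<omega>) \<in> S then 1 else 0 :: real) \<partial>M)"
      by (rule Bochner_Integration.integral_cong[OF refl]) (simp add: indicator_def BG)
    also have "\<dots> = (\<integral>u. (if G u \<in> S then 1 else 0) \<partial>distr M borel U)"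
      by (subst integral_distr) auto
    also have "\<dots> = (\<integral>t. indicator S t * f_BT t \<partial>lborel)"
      unfolding G_def by (rule N.integral_bt[OF np S])
    also have "ennreal \<dots> = (\<integral>\<^sup>+ t. ennreal (indicator S t * f_BT t) \<partial>lborel)"
      using integrable_mult_indicator[OF _ integrable_f_BT(3), of S]
      by (intro nn_integral_eq_integral[symmetric]) (simp_all add: f_BT_nonneg)
    also have "\<dots> = (\<integral>\<^sup>+ t. ennreal (f_BT t) * indicator S t \<partial>lborel)"
      by (intro nn_integral_cong) (simp split: split_indicator)
    also have "\<dots> = emeasure (density lborel (\<lambda>t. ennreal (f_BT t))) S"
      by (rule emeasure_density[symmetric]) auto
    finally show "emeasure (distr M lborel B) S = emeasure (density lborel (\<lambda>t. ennreal (f_BT t))) S" .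
  qed simp
  have lborel_borel: "distr M borel B = distr M lborel B"
    by (rule distr_cong) auto
  have "distributed M lborel B (\<lambda>t. ennreal (f_BT t))"
    unfolding distributed_def using B law by simp
  moreover have "absolutely_continuous lborel (distr M borel B)"
    unfolding lborel_borel law by (rule absolutely_continuousI_density) simp
  moreover have "law_support (distr M borel B) = {\<tau>\<^sub>0..\<tau>\<^sub>3}"
    unfolding lborel_borel law by (rule law_support_f_BT)
  ultimately show ?thesis using B f_BT_nonneg by blast
qed

end
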